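(* Let $\Lambda$ be an index set and let $(G_\lambda,d_\lambda)$, $\lambda\in\Lambda$, be groups with two-sided invariant metrics. Let $A$ be a subgroup of every $G_\lambda$ which is closed in each $G_\lambda$, assume $G_{\lambda_1}\cap G_{\lambda_2}=A$ for $\lambda_1\neq\lambda_2$, and assume $d_{\lambda_1}(a_1,a_2)=d_{\lambda_2}(a_1,a_2)$ for all $a_1,a_2\in A$ and all $\lambda_1,\lambda_2\in\Lambda$. Let $\underline{d}$ be the function on $\coprod_A G_\lambda$ defined in the context. Then: (i) $\underline{d}$ is a two-sided invariant metric on $\coprod_A G_\lambda$ (in particular $\underline d(f,e)=0$ implies $f=e$); (ii) $\underline{d}$ extends the amalgam metric $d$ on $G=\bigcup_\lambda G_\lambda$, i.e. $\underline d(g_1,g_2)=d(g_1,g_2)$ for all $g_1,g_2\in G$.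
   Context: $\coprod_A G_\lambda$ denotes the free product of the groups $G_\lambda$ with amalgamation over $A$; $G=\bigcup_\lambda G_\lambda\subseteq \coprod_A G_\lambda$. The amalgam metric $d$ on $G$ is: $d(f_1,f_2)=d_\lambda(f_1,f_2)$ if $f_1,f_2\in G_\lambda$ for some $\lambda$; and $d(f_1,f_2)=\inf_{a\in A}\{d_{\lambda_1}(f_1,a)+d_{\lambda_2}(a,f_2)\}$ if $f_1\in G_{\lambda_1}$, $f_2\in G_{\lambda_2}$ with $\lambda_1\ne\lambda_2$ (and they do not lie in a common $G_\lambda$). For finite nonempty words $\alpha=\alpha(1)\cdots\alpha(n)$ over the alphabet $G$, $\hat\alpha=\alpha(1)\cdot\alpha(2)\cdots\alpha(n)$ is the product in $\coprod_A G_\lambda$, and for words $\alpha,\beta$ of the same length $n$, $\rho(\alpha,\beta)=\sum_{i=1}^n d(\alpha(i),\beta(i))$. Define $\underline d(f_1,f_2)=\inf\{\rho(\alpha_1,\alpha_2): |\alpha_1|=|\alpha_2|,\ \hat\alpha_1=f_1,\ \hat\alpha_2=f_2\}$ for $f_1,f_2\in\coprod_A G_\lambda$ (the Graev metric on the amalgam). *)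

theory Defs
  imports Complex_Main "HOL-Algebra.Group"
begin

definition alphabet :: "('i \<Rightarrow> 'a monoid) \<Rightarrow> 'a set" where
  "alphabet G = (\<Union>l. carrier (G l))"

text \<open>Elementary reductions of words defining the free product with amalgamation:
  multiply two adjacent letters lying in a common factor, or delete an identity letter.\<close>
inductive_set amal_step :: "('i \<Rightarrow> 'a monoid) \<Rightarrow> ('a list \<times> 'a list) set" for G where
  mult: "\<lbrakk>x \<in> carrier (G l); y \<in> carrier (G l); set u \<subseteq> alphabet G; set v \<subseteq> alphabet G\<rbrakk>
         \<Longrightarrow> (u @ [x, y] @ v, u @ [x \<otimes>\<^bsub>G l\<^esub> y] @ v) \<in> amal_step G"
| unit: "\<lbrakk>set u \<subseteq> alphabet G; set v \<subseteq> alphabet G\<rbrakk>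
         \<Longrightarrow> (u @ [\<one>\<^bsub>G l\<^esub>] @ v, u @ v) \<in> amal_step G"

text \<open>Two words represent the same element of the amalgamated free product
  (product = concatenation of words).\<close>
definition amal_eq :: "('i \<Rightarrow> 'a monoid) \<Rightarrow> ('a list \<times> 'a list) set" where
  "amal_eq G = (amal_step G \<union> (amal_step G)\<inverse>)\<^sup>*"

definition words :: "('i \<Rightarrow> 'a monoid) \<Rightarrow> 'a list set" where
  "words G = {w. set w \<subseteq> alphabet G}"

definition two_sided_inv_metric :: "'a monoid \<Rightarrow> ('a \<Rightarrow> 'a \<Rightarrow> real) \<Rightarrow> bool" where
  "two_sided_inv_metric H d \<longleftrightarrow>
     (\<forall>x\<in>carrier H. \<forall>y\<in>carrier H. d x y \<ge> 0 \<and> (d x y = 0 \<longleftrightarrow> x = y) \<and> d x y = d y x) \<and>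
     (\<forall>x\<in>carrier H. \<forall>y\<in>carrier H. \<forall>z\<in>carrier H. d x z \<le> d x y + d y z) \<and>
     (\<forall>g\<in>carrier H. \<forall>x\<in>carrier H. \<forall>y\<in>carrier H.
        d (g \<otimes>\<^bsub>H\<^esub> x) (g \<otimes>\<^bsub>H\<^esub> y) = d x y \<and> d (x \<otimes>\<^bsub>H\<^esub> g) (y \<otimes>\<^bsub>H\<^esub> g) = d x y)"

definition metric_closed_in :: "'a set \<Rightarrow> 'a monoid \<Rightarrow> ('a \<Rightarrow> 'a \<Rightarrow> real) \<Rightarrow> bool" where
  "metric_closed_in A H d \<longleftrightarrow>
     (\<forall>x\<in>carrier H. (\<forall>e>0. \<exists>a\<in>A. d x a < e) \<longrightarrow> x \<in> A)"

definition amal_metric :: "('i \<Rightarrow> 'a monoid) \<Rightarrow> 'a set \<Rightarrow> ('i \<Rightarrow> 'a \<Rightarrow> 'a \<Rightarrow> real) \<Rightarrow> 'a \<Rightarrow> 'a \<Rightarrow> real" where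
  "amal_metric G A dl f1 f2 =
     (if \<exists>l. f1 \<in> carrier (G l) \<and> f2 \<in> carrier (G l)
      then dl (SOME l. f1 \<in> carrier (G l) \<and> f2 \<in> carrier (G l)) f1 f2
      else Inf {dl l1 f1 a + dl l2 a f2 | a l1 l2.
                  a \<in> A \<and> f1 \<in> carrier (G l1) \<and> f2 \<in> carrier (G l2)})"

definition word_dist :: "('a \<Rightarrow> 'a \<Rightarrow> real) \<Rightarrow> 'a list \<Rightarrow> 'a list \<Rightarrow> real" where
  "word_dist d \<alpha> \<beta> = sum_list (map2 d \<alpha> \<beta>)"

text \<open>The Graev metric on the amalgam, evaluated on (representatives of) elements.\<close>
definition graev_amal :: "('i \<Rightarrow> 'a monoid) \<Rightarrow> 'a set \<Rightarrow> ('i \<Rightarrow> 'a \<Rightarrow> 'a \<Rightarrow> real)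
                          \<Rightarrow> 'a list \<Rightarrow> 'a list \<Rightarrow> real" where
  "graev_amal G A dl f1 f2 =
     Inf {word_dist (amal_metric G A dl) \<alpha>1 \<alpha>2 | \<alpha>1 \<alpha>2.
            \<alpha>1 \<in> words G \<and> \<alpha>2 \<in> words G \<and> \<alpha>1 \<noteq> [] \<and> length \<alpha>1 = length \<alpha>2 \<and>
            (\<alpha>1, f1) \<in> amal_eq G \<and> (\<alpha>2, f2) \<in> amal_eq G}"

end

(*
  The Graev distance of f1 and f2 is the infimum of costs of pairs of words, one for f1 f2^-1 and one
  trivial, whose letters can be assumed to be matched inside a common factor (a letter pair from
  different factors is split at an element of A). Call a labelled word near to r if some trivial
  word with the same labels lies within cost r. The key point is that this only depends on the element
  represented by the word. Merging neighbours is harmless by invariance of the metrics. Deleting an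
  identity letter rests on the following: a word that represents an element g of one factor can be made
  trivial, keeping its labels, at cost |g|; this follows by induction on the length, since by the
  normal form theorem such a word has length at most 1 or can be shortened. Hence the distance can
  be computed on any one representation of f1 f2^-1: on a reduced one, where some letter of a trivial
  word of the same shape is in A, closedness of A makes it positive, and on words of length at
  most 2 it is the amalgam metric.
*)

theory Submission
  imports Defs "HOL-Algebra.Coset"
begin

section \<open>Normal forms\<close>

locale group_amalgam =
  fixes G :: "'i \<Rightarrow> 'a monoid" and A :: "'a set"
  assumes grp: "\<And>l. group (G l)"
    and sub: "\<And>l. subgroup A (G l)"
    and A_mult: "\<And>l1 l2 a b. a \<in> A \<Longrightarrow> b \<in> A \<Longrightarrow> a \<otimes>\<^bsub>G l1\<^esub> b = a \<otimes>\<^bsub>G l2\<^esub> b"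
    and inter: "\<And>l1 l2. l1 \<noteq> l2 \<Longrightarrow> carrier (G l1) \<inter> carrier (G l2) = A"
begin

section \<open>Calculus in the factors and in the common subgroup\<close>

lemma mon: "monoid (G l)"
  using grp group.is_monoid by blast

lemmas G_simps [simp] =
  monoid.m_closed[OF mon] monoid.one_closed[OF mon] monoid.l_one[OF mon] monoid.r_one[OF mon]
  group.inv_closed[OF grp] group.l_inv[OF grp] group.r_inv[OF grp] group.inv_inv[OF grp]

lemmas G_assoc = monoid.m_assoc[OF mon]

lemma inv_cancel [simp]:
  assumes "x \<in> carrier (G l)" "y \<in> carrier (G l)"
  shows "inv\<^bsub>G l\<^esub> x \<otimes>\<^bsub>G l\<^esub> (x \<otimes>\<^bsub>G l\<^esub> y) = y" "x \<otimes>\<^bsub>G l\<^esub> (inv\<^bsub>G l\<^esub> x \<otimes>\<^bsub>G l\<^esub> y) = y"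
    "x \<otimes>\<^bsub>G l\<^esub> y \<otimes>\<^bsub>G l\<^esub> inv\<^bsub>G l\<^esub> y = x" "x \<otimes>\<^bsub>G l\<^esub> inv\<^bsub>G l\<^esub> y \<otimes>\<^bsub>G l\<^esub> y = x"
  using assms by (auto simp: G_assoc simp flip: G_assoc[of "inv\<^bsub>G l\<^esub> x"] G_assoc[of x])

lemma A_carrier [simp]: "a \<in> A \<Longrightarrow> a \<in> carrier (G l)"
  using sub subgroup.mem_carrier by metis

lemma A_closed [simp]:
  "a \<in> A \<Longrightarrow> b \<in> A \<Longrightarrow> a \<otimes>\<^bsub>G l\<^esub> b \<in> A" "\<one>\<^bsub>G l\<^esub> \<in> A" "a \<in> A \<Longrightarrow> inv\<^bsub>G l\<^esub> a \<in> A"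
  using sub subgroup.m_closed subgroup.one_closed subgroup.m_inv_closed by metis+

lemma in_A_if_two_factors: "x \<in> carrier (G l) \<Longrightarrow> x \<in> carrier (G m) \<Longrightarrow> l \<noteq> m \<Longrightarrow> x \<in> A"
  using inter by blast

text \<open>The unit of one factor is idempotent in another by \<open>A_mult\<close>, hence equal to
  the unit there.\<close>

lemma one_eq: "\<one>\<^bsub>G l\<^esub> = \<one>\<^bsub>G m\<^esub>"
proof -
  have "\<one>\<^bsub>G l\<^esub> \<otimes>\<^bsub>G m\<^esub> \<one>\<^bsub>G l\<^esub> = \<one>\<^bsub>G l\<^esub>"
    using A_mult[of "\<one>\<^bsub>G l\<^esub>" "\<one>\<^bsub>G l\<^esub>" m l] by simp
  then show ?thesis
    using group.l_cancel_one[OF grp, of "\<one>\<^bsub>G l\<^esub>" m "\<one>\<^bsub>G l\<^esub>"] by simp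
qed

lemma inv_A_eq: "a \<in> A \<Longrightarrow> inv\<^bsub>G l\<^esub> a = inv\<^bsub>G m\<^esub> a"
  by (rule group.inv_equality[OF grp]) (simp_all add: A_mult[of _ _ l m] one_eq[of l m])

lemma A_mult_iff [simp]:
  assumes "a \<in> A" "x \<in> carrier (G l)"
  shows "a \<otimes>\<^bsub>G l\<^esub> x \<in> A \<longleftrightarrow> x \<in> A" "x \<otimes>\<^bsub>G l\<^esub> a \<in> A \<longleftrightarrow> x \<in> A"
  using assms A_closed A_carrier inv_cancel by metis+

section \<open>Representatives of the right cosets of \<open>A\<close>\<close>

definition rep :: "'i \<Rightarrow> 'a \<Rightarrow> 'a" where
  "rep l x = (SOME y. y \<in> A #>\<^bsub>G l\<^esub> x)"

lemma rep_in: "x \<in> carrier (G l) \<Longrightarrow> rep l x \<in> A #>\<^bsub>G l\<^esub> x"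
  unfolding rep_def by (rule someI_ex) (use group.rcos_self[OF grp] sub in blast)

lemma rep_coset:
  assumes "x \<in> carrier (G l)"
  obtains a where "a \<in> A" "rep l x = a \<otimes>\<^bsub>G l\<^esub> x"
  using rep_in[OF assms] unfolding r_coset_def by auto

lemma rep_carrier [simp]: "x \<in> carrier (G l) \<Longrightarrow> rep l x \<in> carrier (G l)"
  by (metis G_simps(1) A_carrier rep_coset)

lemma rep_A_iff [simp]: "x \<in> carrier (G l) \<Longrightarrow> rep l x \<in> A \<longleftrightarrow> x \<in> A"
  by (metis A_mult_iff(1) rep_coset)

text \<open>\<open>rep\<close> chooses from the coset as a set, so it sees \<open>x\<close> only
  through its coset, which does not change under left multiplication by \<open>A\<close>.\<close>

lemma rep_mult [simp]:
  assumes "a \<in> A" "x \<in> carrier (G l)"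
  shows "rep l (a \<otimes>\<^bsub>G l\<^esub> x) = rep l x"
proof -
  have "a \<otimes>\<^bsub>G l\<^esub> x \<in> A #>\<^bsub>G l\<^esub> x"
    using assms unfolding r_coset_def by auto
  then have "A #>\<^bsub>G l\<^esub> x = A #>\<^bsub>G l\<^esub> (a \<otimes>\<^bsub>G l\<^esub> x)"
    using group.repr_independence[OF grp] assms sub by metis
  then show ?thesis by (simp add: rep_def)
qed

lemma rep_rep [simp]: "x \<in> carrier (G l) \<Longrightarrow> rep l (rep l x) = rep l x"
  by (metis rep_coset rep_mult)

text \<open>Splits \<open>x\<close> into an element of \<open>A\<close> and a coset representative;
  \<open>join_nf\<close> keeps the former as the new head.\<close>

lemma mult_inv_rep_A [simp]:
  assumes "x \<in> carrier (G l)"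
  shows "x \<otimes>\<^bsub>G l\<^esub> inv\<^bsub>G l\<^esub> (rep l x) \<in> A"
proof -
  obtain a where a: "a \<in> A" "rep l x = a \<otimes>\<^bsub>G l\<^esub> x" using rep_coset assms .
  then have "x \<otimes>\<^bsub>G l\<^esub> inv\<^bsub>G l\<^esub> (rep l x) = inv\<^bsub>G l\<^esub> a"
    using assms by (simp add: group.inv_mult_group[OF grp] flip: G_assoc)
  then show ?thesis using a by simp
qed

section \<open>Normal forms and the action of the factors on them\<close>

definition good_tail :: "('i \<times> 'a) list \<Rightarrow> bool" where
  "good_tail ts \<longleftrightarrow> distinct_adj (map fst ts) \<and>
     (\<forall>(l, t) \<in> set ts. t \<in> carrier (G l) \<and> t \<notin> A \<and> rep l t = t)"

text \<open>The pair \<open>(a, [(l\<^sub>1, t\<^sub>1), \<dots>, (l\<^sub>n, t\<^sub>n)])\<close> stands for the product \<open>a t\<^sub>1 \<dots> t\<^sub>n\<close>, where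
  \<open>t\<^sub>i\<close> is a chosen representative of a nontrivial coset of \<open>A\<close> in \<open>G l\<^sub>i\<close>.\<close>

definition normal_forms :: "('a \<times> ('i \<times> 'a) list) set" where
  "normal_forms = {(a, ts). a \<in> A \<and> good_tail ts}"

definition off :: "'i \<Rightarrow> ('i \<times> 'a) list \<Rightarrow> bool" where
  "off l ts \<longleftrightarrow> ts = [] \<or> fst (hd ts) \<noteq> l"

text \<open>Gathers the head and a first syllable of label \<open>l\<close> into one element of
  \<open>G l\<close>. With \<open>join_nf\<close> as inverse, normal forms correspond to pairs of an
  element of \<open>G l\<close> and a good tail with \<open>off l\<close>; in these coordinates
  \<open>G l\<close> can act by left multiplication.\<close>

fun split_nf :: "'i \<Rightarrow> 'a \<times> ('i \<times> 'a) list \<Rightarrow> 'a \<times> ('i \<times> 'a) list" where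
  "split_nf l (a, []) = (a, [])"
| "split_nf l (a, (m, t) # ts) = (if m = l then (a \<otimes>\<^bsub>G l\<^esub> t, ts) else (a, (m, t) # ts))"

fun join_nf :: "'i \<Rightarrow> 'a \<times> ('i \<times> 'a) list \<Rightarrow> 'a \<times> ('i \<times> 'a) list" where
  "join_nf l (h, ts) =
     (if h \<in> A then (h, ts) else (h \<otimes>\<^bsub>G l\<^esub> inv\<^bsub>G l\<^esub> (rep l h), (l, rep l h) # ts))"

text \<open>Van der Waerden's device: letting the factors act on the normal forms yields an
  invariant of words, so that uniqueness of normal forms needs no confluence argument for the
  reductions.\<close>

definition act :: "'i \<Rightarrow> 'a \<Rightarrow> 'a \<times> ('i \<times> 'a) list \<Rightarrow> 'a \<times> ('i \<times> 'a) list" where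
  "act l g s = join_nf l (g \<otimes>\<^bsub>G l\<^esub> fst (split_nf l s), snd (split_nf l s))"

lemma good_tail_Cons:
  "good_tail ((l, t) # ts) \<longleftrightarrow>
     t \<in> carrier (G l) \<and> t \<notin> A \<and> rep l t = t \<and> off l ts \<and> good_tail ts"
  by (cases ts) (auto simp: good_tail_def off_def)

lemma split_nf_off: "off l ts \<Longrightarrow> split_nf l (a, ts) = (a, ts)"
  by (cases ts) (auto simp: off_def)

lemma split_nf_props:
  assumes "s \<in> normal_forms"
  shows "fst (split_nf l s) \<in> carrier (G l)" "off l (snd (split_nf l s))"
    "good_tail (snd (split_nf l s))"
  using assms
  by (cases "(l, s)" rule: split_nf.cases; auto simp: normal_forms_def good_tail_Cons off_def)+

lemma join_split:
  assumes "s \<in> normal_forms"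
  shows "join_nf l (split_nf l s) = s"
  using assms
  by (cases "(l, s)" rule: split_nf.cases) (auto simp: normal_forms_def good_tail_Cons)

lemma split_join:
  assumes "h \<in> carrier (G l)" "off l ts"
  shows "split_nf l (join_nf l (h, ts)) = (h, ts)"
  using assms by (auto simp: split_nf_off)

lemma join_normal:
  assumes "h \<in> carrier (G l)" "off l ts" "good_tail ts"
  shows "join_nf l (h, ts) \<in> normal_forms"
  using assms by (auto simp: normal_forms_def good_tail_Cons)

lemma act_normal: "g \<in> carrier (G l) \<Longrightarrow> s \<in> normal_forms \<Longrightarrow> act l g s \<in> normal_forms"
  unfolding act_def by (intro join_normal) (auto simp: split_nf_props)

text \<open>Splitting undoes joining, so in split coordinates both sides are left multiplications
  and the claim is associativity.\<close>

lemma act_act: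
  assumes "g \<in> carrier (G l)" "h \<in> carrier (G l)" "s \<in> normal_forms"
  shows "act l g (act l h s) = act l (g \<otimes>\<^bsub>G l\<^esub> h) s"
proof -
  have "split_nf l (act l h s) = (h \<otimes>\<^bsub>G l\<^esub> fst (split_nf l s), snd (split_nf l s))"
    unfolding act_def using assms by (intro split_join) (simp_all add: split_nf_props)
  then show ?thesis
    using assms by (simp add: act_def[of l g] act_def[of l "g \<otimes>\<^bsub>G l\<^esub> h"] split_nf_props G_assoc
        del: join_nf.simps)
qed

lemma act_one: "s \<in> normal_forms \<Longrightarrow> act l \<one>\<^bsub>G l\<^esub> s = s"
  unfolding act_def by (simp add: split_nf_props join_split del: join_nf.simps)

text \<open>Left multiplication by \<open>A\<close> changes neither the coset nor its
  representative, so only the head is affected, whether or not the first syllable has label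
  \<open>l\<close>.\<close>

lemma act_A:
  assumes "b \<in> A" "(a, ts) \<in> normal_forms"
  shows "act l b (a, ts) = (b \<otimes>\<^bsub>G l\<^esub> a, ts)"
proof (cases ts)
  case Nil
  then show ?thesis using assms by (auto simp: act_def normal_forms_def)
next
  case (Cons p ts')
  obtain m t where p: "p = (m, t)" by force
  then have *: "a \<in> A" "t \<in> carrier (G m)" "t \<notin> A" "rep m t = t"
    using assms Cons by (auto simp: normal_forms_def good_tail_Cons)
  then have "b \<otimes>\<^bsub>G m\<^esub> (a \<otimes>\<^bsub>G m\<^esub> t) = b \<otimes>\<^bsub>G m\<^esub> a \<otimes>\<^bsub>G m\<^esub> t"
    using assms(1) by (simp add: G_assoc)
  then show ?thesis using assms Cons p * by (auto simp: act_def)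
qed

text \<open>Letters of \<open>A\<close> carry no label, but they act in the same way in every factor.\<close>

definition lact :: "'a \<Rightarrow> 'a \<times> ('i \<times> 'a) list \<Rightarrow> 'a \<times> ('i \<times> 'a) list" where
  "lact x = act (SOME l. x \<in> carrier (G l)) x"

text \<open>Two factors containing \<open>x\<close> are equal or force \<open>x \<in> A\<close>, and
  then \<open>act_A\<close> and \<open>A_mult\<close> show that the label is irrelevant.\<close>

lemma lact_eq:
  assumes "x \<in> carrier (G l)" "s \<in> normal_forms"
  shows "lact x s = act l x s"
proof -
  define m where "m = (SOME l. x \<in> carrier (G l))"
  have m: "x \<in> carrier (G m)" unfolding m_def using assms by (metis someI_ex)
  show ?thesis
  proof (cases "m = l")
    case False
    then have "x \<in> A" using m assms in_A_if_two_factors by blast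
    moreover obtain a ts where s: "s = (a, ts)" by force
    moreover have "a \<in> A" using s assms by (auto simp: normal_forms_def)
    ultimately show ?thesis
      using assms(2) A_mult[of x a m l] unfolding lact_def m_def[symmetric] by (simp add: act_A)
  qed (simp add: lact_def m_def)
qed

text \<open>The letters are applied to the normal form of the empty word. The label
  \<open>undefined\<close> stands for an arbitrary factor, since all units agree by
  \<open>one_eq\<close>.\<close>

definition nf :: "'a list \<Rightarrow> 'a \<times> ('i \<times> 'a) list" where
  "nf w = foldr lact w (\<one>\<^bsub>G undefined\<^esub>, [])"

lemma nf_Nil: "nf [] = (\<one>\<^bsub>G l\<^esub>, [])"
  using one_eq by (simp add: nf_def)

lemma lact_normal: "x \<in> alphabet G \<Longrightarrow> s \<in> normal_forms \<Longrightarrow> lact x s \<in> normal_forms"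
  by (auto simp only: alphabet_def lact_eq act_normal)

lemma foldr_lact_normal:
  "set w \<subseteq> alphabet G \<Longrightarrow> s \<in> normal_forms \<Longrightarrow> foldr lact w s \<in> normal_forms"
  by (induction w) (auto simp: lact_normal)

lemma nf_normal: "set w \<subseteq> alphabet G \<Longrightarrow> nf w \<in> normal_forms"
  unfolding nf_def by (rule foldr_lact_normal) (auto simp: normal_forms_def good_tail_def)

lemma nf_Cons: "x \<in> carrier (G l) \<Longrightarrow> set w \<subseteq> alphabet G \<Longrightarrow> nf (x # w) = act l x (nf w)"
  using lact_eq[OF _ nf_normal] by (simp add: nf_def)

lemma nf_append: "nf (u @ v) = foldr lact u (nf v)"
  by (simp add: nf_def)

lemma carrier_alphabet [simp]: "x \<in> carrier (G l) \<Longrightarrow> x \<in> alphabet G"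
  by (auto simp: alphabet_def)

text \<open>The two kinds of reduction correspond to the two laws \<open>act_act\<close> and
  \<open>act_one\<close> of an action.\<close>

lemma nf_step: "(w, w') \<in> amal_step G \<Longrightarrow> nf w = nf w'"
proof (induction rule: amal_step.induct)
  case (mult x l y u v)
  then have "nf (x # y # v) = nf (x \<otimes>\<^bsub>G l\<^esub> y # v)"
    using nf_normal by (simp add: nf_Cons[of _ l] act_act)
  then show ?case by (simp add: nf_append)
next
  case (unit u v l)
  then show ?case using nf_normal by (simp add: nf_append nf_Cons[of _ l] act_one)
qed

lemma nf_eq: "(w, w') \<in> amal_eq G \<Longrightarrow> nf w = nf w'"
  unfolding amal_eq_def by (induction rule: rtrancl_induct) (auto dest: nf_step)

lemma nf_single:
  "x \<in> carrier (G l) \<Longrightarrow> nf [x] = join_nf l (x, [])"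
  by (simp add: nf_Cons nf_Nil[of l] act_def)

text \<open>The factors embed in the amalgamated product: a letter outside \<open>A\<close> shows
  its factor as the label in its normal form, and \<open>split_join\<close> recovers the
  letter.\<close>

lemma amal_eq_single:
  assumes "([x], [y]) \<in> amal_eq G" "x \<in> alphabet G" "y \<in> alphabet G"
  shows "x = y"
proof -
  obtain l m where lm: "x \<in> carrier (G l)" "y \<in> carrier (G m)"
    using assms by (auto simp: alphabet_def)
  then have eq: "join_nf l (x, []) = join_nf m (y, [])"
    using nf_eq[OF assms(1)] by (simp add: nf_single)
  show ?thesis
  proof (cases "x \<in> A")
    case True
    then show ?thesis using eq by (auto split: if_splits)
  next
    case False
    then have "m = l" using eq by (auto split: if_splits)
    then show ?thesis using eq split_join[of x l "[]"] split_join[of y l "[]"] lm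
      by (simp add: off_def del: join_nf.simps)
  qed
qed

section \<open>Reduced words and their length\<close>

lemma length_nf_le: "set w \<subseteq> alphabet G \<Longrightarrow> length (snd (nf w)) \<le> length w"
proof (induction w)
  case (Cons x w)
  then obtain l where "x \<in> carrier (G l)" by (auto simp: alphabet_def)
  then have "nf (x # w) = act l x (nf w)" using Cons.prems nf_Cons by simp
  moreover have "length (snd (act l x s)) \<le> Suc (length (snd s))" for s
    by (cases "(l, s)" rule: split_nf.cases) (auto simp: act_def)
  moreover have "Suc (length (snd (nf w))) \<le> length (x # w)" using Cons by simp
  ultimately show ?case by (metis le_trans)
qed (simp add: nf_def)

text \<open>A letter of \<open>A\<close> lies in every factor, so the factor in which a letter is to
  be matched is recorded with it.\<close>

definition labelled :: "('i \<times> 'a) list \<Rightarrow> bool" where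
  "labelled w \<longleftrightarrow> (\<forall>(l, x) \<in> set w. x \<in> carrier (G l))"

definition reduced :: "('i \<times> 'a) list \<Rightarrow> bool" where
  "reduced w \<longleftrightarrow> distinct_adj (map fst w) \<and> (\<forall>(l, x) \<in> set w. x \<notin> A)"

lemma labelled_simps [simp]:
  "labelled []" "labelled ((l, x) # w) \<longleftrightarrow> x \<in> carrier (G l) \<and> labelled w"
  "labelled (u @ v) \<longleftrightarrow> labelled u \<and> labelled v"
  by (auto simp: labelled_def)

lemma labelled_words: "labelled w \<Longrightarrow> set (map snd w) \<subseteq> alphabet G"
  by (force simp: labelled_def alphabet_def)

text \<open>No letter of a reduced word is absorbed: the next syllable has another label and the
  letter is not in \<open>A\<close>, so each letter adds one syllable with its own label.\<close>

lemma nf_reduced: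
  "labelled w \<Longrightarrow> reduced w \<Longrightarrow> map fst (snd (nf (map snd w))) = map fst w"
proof (induction w)
  case (Cons p w)
  obtain l x where p: "p = (l, x)" by force
  obtain a ts where nf: "nf (map snd w) = (a, ts)" by force
  have w: "labelled w" "reduced w" "x \<in> carrier (G l)" "x \<notin> A"
    using Cons.prems p by (auto simp: reduced_def distinct_adj_Cons)
  then have IH: "map fst ts = map fst w" using Cons.IH nf by simp
  have "a \<in> A" using nf_normal[OF labelled_words[OF w(1)]] nf by (auto simp: normal_forms_def)
  moreover have "off l ts"
    using Cons.prems(2) IH p by (cases ts; cases w) (auto simp: reduced_def off_def)
  ultimately show ?case
    using w IH nf labelled_words[OF w(1)] p
    by (simp add: nf_Cons[of x l] act_def split_nf_off)
qed (simp add: nf_def)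

text \<open>The normal form theorem in the shape used below: both words have the same normal form,
  with one syllable per letter of \<open>w\<close> and at most one per letter of
  \<open>v\<close>.\<close>

lemma reduced_length_le:
  assumes "labelled w" "reduced w" "(map snd w, v) \<in> amal_eq G" "set v \<subseteq> alphabet G"
  shows "length w \<le> length v"
  using nf_reduced[OF assms(1,2)] nf_eq[OF assms(3)] length_nf_le[OF assms(4)]
  by (metis length_map)

text \<open>Induction by shortening: a word of length at least 2 that is not reduced has two
  neighbours with equal labels or with one of them in \<open>A\<close>, and these multiply inside
  one factor. In \<open>mergeL\<close> the product takes the right label, in \<open>mergeR\<close>
  the left one.\<close>

lemma labelled_induct [consumes 1, case_names Nil single reduced mergeL mergeR]:
  fixes w :: "('i \<times> 'a) list"
  assumes "labelled w"
    and "P []"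
    and "\<And>l x. x \<in> carrier (G l) \<Longrightarrow> P [(l, x)]"
    and "\<And>w. labelled w \<Longrightarrow> reduced w \<Longrightarrow> length w \<ge> 2 \<Longrightarrow> P w"
    and "\<And>u m x k y v. labelled (u @ (m, x) # (k, y) # v) \<Longrightarrow> x \<in> carrier (G k) \<Longrightarrow> m = k \<or> x \<in> A
          \<Longrightarrow> P (u @ (k, x \<otimes>\<^bsub>G k\<^esub> y) # v) \<Longrightarrow> P (u @ (m, x) # (k, y) # v)"
    and "\<And>u m x k y v. labelled (u @ (m, x) # (k, y) # v) \<Longrightarrow> y \<in> A
          \<Longrightarrow> P (u @ (m, x \<otimes>\<^bsub>G m\<^esub> y) # v) \<Longrightarrow> P (u @ (m, x) # (k, y) # v)"
  shows "P w"
  using assms(1)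
proof (induction "length w" arbitrary: w rule: less_induct)
  case less
  \<comment> \<open>The length bound matters: a single letter of \<open>A\<close> is not reduced but
    has no neighbour to merge with.\<close>
  have bad_pair: "\<exists>u m x k y v. z = u @ (m, x) # (k, y) # v \<and> (m = k \<or> x \<in> A \<or> y \<in> A)"
    if "\<not> reduced z" "length z \<ge> 2" for z
    using that
  proof (induction z rule: induct_list012)
    case (3 p q w)
    obtain m x k y where pq: "p = (m, x)" "q = (k, y)" by force
    show ?case
    proof (cases "m = k \<or> x \<in> A \<or> y \<in> A")
      case True
      then show ?thesis using pq by (metis append_Nil)
    next
      case False
      then have "\<not> reduced (q # w)" using 3 pq by (auto simp: reduced_def)
      moreover from this have "length (q # w) \<ge> 2"
        using False pq by (cases w) (auto simp: reduced_def)
      ultimately show ?thesis using 3 by (metis append_Cons)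
    qed
  qed auto
  consider "w = []" | p where "w = [p]" | "length w \<ge> 2" by (cases w; cases "tl w") auto
  then show ?case
  proof cases
    case 2
    then show ?thesis using less assms(3) by (cases p) auto
  next
    case 3
    show ?thesis
    proof (cases "reduced w")
      case False
      then obtain u m x k y v where w: "w = u @ (m, x) # (k, y) # v" "m = k \<or> x \<in> A \<or> y \<in> A"
        using bad_pair 3 by blast
      then show ?thesis
        using less(2) less(1)[of "u @ (k, x \<otimes>\<^bsub>G k\<^esub> y) # v"]
          less(1)[of "u @ (m, x \<otimes>\<^bsub>G m\<^esub> y) # v"]
          assms(5)[of u m x k y v] assms(6)[of u m x k y v]
        by auto
    qed (use less assms(4) 3 in blast)
  qed (use assms(2) in simp)
qed

section \<open>Words up to equivalence\<close>

lemma amal_eq_refl [simp]: "(w, w) \<in> amal_eq G"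
  by (simp add: amal_eq_def)

lemma amal_eq_sym: "(u, v) \<in> amal_eq G \<Longrightarrow> (v, u) \<in> amal_eq G"
  unfolding amal_eq_def by (meson sym_Un_converse sym_rtrancl symD)

lemma amal_eq_trans: "(u, v) \<in> amal_eq G \<Longrightarrow> (v, w) \<in> amal_eq G \<Longrightarrow> (u, w) \<in> amal_eq G"
  unfolding amal_eq_def by simp

lemma amal_eq_trans_sym: "(u, v) \<in> amal_eq G \<Longrightarrow> (u, w) \<in> amal_eq G \<Longrightarrow> (v, w) \<in> amal_eq G"
  using amal_eq_sym amal_eq_trans by blast

lemma amal_step_words: "(u, v) \<in> amal_step G \<Longrightarrow> u \<in> words G \<and> v \<in> words G"
proof (induction rule: amal_step.induct)
  case (mult x l y u v)
  then show ?case using carrier_alphabet[of "x \<otimes>\<^bsub>G l\<^esub> y" l] by (simp add: words_def)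
next
  case (unit u v l)
  then show ?case using carrier_alphabet[of "\<one>\<^bsub>G l\<^esub>" l] by (simp add: words_def)
qed

lemma amal_step_eq: "(u, v) \<in> amal_step G \<Longrightarrow> (u, v) \<in> amal_eq G"
  unfolding amal_eq_def by auto

lemma amal_eq_cong:
  assumes "(x, y) \<in> amal_eq G" "u \<in> words G" "v \<in> words G"
  shows "(u @ x @ v, u @ y @ v) \<in> amal_eq G"
proof -
  have step: "(u @ x @ v, u @ y @ v) \<in> amal_step G" if "(x, y) \<in> amal_step G" for x y
    using that
  proof (induction rule: amal_step.induct)
    case (mult x l y u' v')
    then show ?case using assms amal_step.mult[of x G l y "u @ u'" "v' @ v"] by (simp add: words_def)
  next
    case (unit u' v' l)
    then show ?case using assms amal_step.unit[of "u @ u'" G "v' @ v" l] by (simp add: words_def)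
  qed
  from assms(1) show ?thesis
    unfolding amal_eq_def
    by (induction rule: rtrancl_induct) (auto dest: step intro: rtrancl_into_rtrancl)
qed

lemma amal_eq_append:
  assumes "(u, u') \<in> amal_eq G" "(v, v') \<in> amal_eq G" "u' \<in> words G" "v \<in> words G"
  shows "(u @ v, u' @ v') \<in> amal_eq G"
  using amal_eq_trans[of "u @ v" "u' @ v" "u' @ v'"] amal_eq_cong[of u u' "[]" v]
    amal_eq_cong[of v v' u' "[]"] assms
  by (simp add: words_def)

lemma words_simps [simp]:
  "[] \<in> words G" "x # w \<in> words G \<longleftrightarrow> x \<in> alphabet G \<and> w \<in> words G"
  "u @ v \<in> words G \<longleftrightarrow> u \<in> words G \<and> v \<in> words G"
  by (auto simp: words_def)

lemma amal_eq_mult: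
  assumes "x \<in> carrier (G l)" "y \<in> carrier (G l)" "u \<in> words G" "v \<in> words G"
  shows "(u @ x # y # v, u @ (x \<otimes>\<^bsub>G l\<^esub> y) # v) \<in> amal_eq G"
  using amal_step_eq[OF amal_step.mult[of x G l y u v]] assms by (simp add: words_def)

lemma amal_eq_one:
  "u \<in> words G \<Longrightarrow> v \<in> words G \<Longrightarrow> (u @ \<one>\<^bsub>G l\<^esub> # v, u @ v) \<in> amal_eq G"
  using amal_step_eq[OF amal_step.unit[of u G v l]] by (simp add: words_def)

lemma amal_eq_single_one:
  assumes "([z], []) \<in> amal_eq G" "z \<in> carrier (G l)"
  shows "z = \<one>\<^bsub>G l\<^esub>"
proof -
  have "([\<one>\<^bsub>G l\<^esub>], []) \<in> amal_eq G" using amal_eq_one[of "[]" "[]" l] by simp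
  then have "([z], [\<one>\<^bsub>G l\<^esub>]) \<in> amal_eq G" using assms(1) amal_eq_sym amal_eq_trans by blast
  then show ?thesis
    by (rule amal_eq_single) (use assms carrier_alphabet[of _ l] in auto)
qed

section \<open>Inverse words and cancellation\<close>

definition linv :: "'a \<Rightarrow> 'a" where
  "linv x = inv\<^bsub>G (SOME l. x \<in> carrier (G l))\<^esub> x"

definition winv :: "'a list \<Rightarrow> 'a list" where
  "winv w = rev (map linv w)"

text \<open>The factor chosen in \<open>linv\<close> does not matter, as an element of
  \<open>A\<close> has the same inverse in all factors.\<close>

lemma linv_eq:
  assumes "x \<in> carrier (G l)"
  shows "linv x = inv\<^bsub>G l\<^esub> x"
proof -
  define m where "m = (SOME l. x \<in> carrier (G l))"
  have "x \<in> carrier (G m)" unfolding m_def using assms by (metis someI_ex)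
  then have "m = l \<or> x \<in> A" using assms in_A_if_two_factors by blast
  then have "inv\<^bsub>G m\<^esub> x = inv\<^bsub>G l\<^esub> x" using inv_A_eq by blast
  then show ?thesis by (simp add: linv_def m_def)
qed

lemma linv_alphabet [simp]: "x \<in> alphabet G \<Longrightarrow> linv x \<in> alphabet G"
  using linv_eq by (metis UN_E alphabet_def carrier_alphabet G_simps(5))

lemma winv_words [simp]: "w \<in> words G \<Longrightarrow> winv w \<in> words G"
  by (auto simp: words_def winv_def)

lemma linv_cancel:
  assumes "x \<in> alphabet G" "u \<in> words G" "v \<in> words G"
  shows "(u @ x # linv x # v, u @ v) \<in> amal_eq G" "(u @ linv x # x # v, u @ v) \<in> amal_eq G"
proof -
  obtain l where l: "x \<in> carrier (G l)" using assms by (auto simp: alphabet_def)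
  show "(u @ x # linv x # v, u @ v) \<in> amal_eq G" "(u @ linv x # x # v, u @ v) \<in> amal_eq G"
    using amal_eq_mult[of x l "linv x" u v] amal_eq_mult[of "linv x" l x u v]
      amal_eq_trans[OF _ amal_eq_one[of u v l]] l assms linv_eq[OF l] by simp_all
qed

lemma winv_cancel:
  assumes "w \<in> words G"
  shows "(w @ winv w, []) \<in> amal_eq G" "(winv w @ w, []) \<in> amal_eq G"
proof (atomize (full), use assms in \<open>induction w\<close>)
  case (Cons x w)
  then have IH: "(w @ winv w, []) \<in> amal_eq G" "(winv w @ w, []) \<in> amal_eq G" by simp_all
  have "(x # w @ winv w @ [linv x], [x, linv x]) \<in> amal_eq G"
    using amal_eq_cong[OF IH(1), of "[x]" "[linv x]"] Cons.prems by simp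
  then have fwd: "((x # w) @ winv (x # w), []) \<in> amal_eq G"
    using amal_eq_trans[OF _ linv_cancel(1)[of x "[]" "[]"]] Cons.prems by (simp add: winv_def)
  have "(winv w @ linv x # x # w, winv w @ w) \<in> amal_eq G"
    using linv_cancel(2)[of x "winv w" w] Cons.prems by simp
  then have "(winv (x # w) @ x # w, []) \<in> amal_eq G"
    using amal_eq_trans[OF _ IH(2)] by (simp add: winv_def)
  with fwd show ?case by simp
qed (auto simp: winv_def)

lemma amal_eq_cancel_left:
  assumes "(u @ v, u @ w) \<in> amal_eq G" "u \<in> words G" "v \<in> words G" "w \<in> words G"
  shows "(v, w) \<in> amal_eq G"
proof -
  have *: "(winv u @ u @ v, v) \<in> amal_eq G" if "v \<in> words G" for v
    using amal_eq_cong[OF winv_cancel(2), of u "[]" v] that assms(2) by simp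
  have "(winv u @ u @ v, winv u @ u @ w) \<in> amal_eq G"
    using amal_eq_cong[OF assms(1), of "winv u" "[]"] assms(2) by simp
  then show ?thesis
    using amal_eq_trans_sym[OF *[OF assms(3)]] amal_eq_trans[OF _ *[OF assms(4)]] by blast
qed

lemma amal_eq_cancel_right:
  assumes "(v @ u, w @ u) \<in> amal_eq G" "u \<in> words G" "v \<in> words G" "w \<in> words G"
  shows "(v, w) \<in> amal_eq G"
proof -
  have *: "(v @ u @ winv u, v) \<in> amal_eq G" if "v \<in> words G" for v
    using amal_eq_cong[OF winv_cancel(1), of u v "[]"] that assms(2) by simp
  have "(v @ u @ winv u, w @ u @ winv u) \<in> amal_eq G"
    using amal_eq_cong[OF assms(1), of "[]" "winv u"] assms(2) by simp
  then show ?thesis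
    using amal_eq_trans_sym[OF *[OF assms(3)]] amal_eq_trans[OF _ *[OF assms(4)]] by blast
qed

text \<open>Cancel \<open>u\<close> on the left of \<open>u v u = u\<close>.\<close>

lemma amal_eq_rotate:
  assumes "(u @ v, []) \<in> amal_eq G" "u \<in> words G" "v \<in> words G"
  shows "(v @ u, []) \<in> amal_eq G"
  using amal_eq_cancel_left[of u "v @ u" "[]"] amal_eq_cong[OF assms(1), of "[]" u] assms by simp

lemma reduced_single:
  assumes "labelled w" "reduced w" "length w \<ge> 2" "x \<in> alphabet G"
  shows "(map snd w, [x]) \<notin> amal_eq G"
  using reduced_length_le[of w "[x]"] assms by auto

end

section \<open>Distance to the trivial words of the same shape\<close>

locale metric_amalgam = group_amalgam G A
  for G :: "'i \<Rightarrow> 'a monoid" and A :: "'a set" +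
  fixes dl :: "'i \<Rightarrow> 'a \<Rightarrow> 'a \<Rightarrow> real"
  assumes metric: "\<And>l. two_sided_inv_metric (G l) (dl l)"
    and closed: "\<And>l. metric_closed_in A (G l) (dl l)"
    and A_metric: "\<And>l1 l2 a b. a \<in> A \<Longrightarrow> b \<in> A \<Longrightarrow> dl l1 a b = dl l2 a b"
begin

section \<open>Invariance of the factor metrics\<close>

lemma dl_nonneg [simp]: "x \<in> carrier (G l) \<Longrightarrow> y \<in> carrier (G l) \<Longrightarrow> 0 \<le> dl l x y"
  using metric[of l] unfolding two_sided_inv_metric_def by blast

lemma dl_eq_0_iff [simp]:
  "x \<in> carrier (G l) \<Longrightarrow> y \<in> carrier (G l) \<Longrightarrow> dl l x y = 0 \<longleftrightarrow> x = y"
  using metric[of l] unfolding two_sided_inv_metric_def by blast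

lemma dl_self [simp]: "x \<in> carrier (G l) \<Longrightarrow> dl l x x = 0"
  by simp

lemma dl_sym: "x \<in> carrier (G l) \<Longrightarrow> y \<in> carrier (G l) \<Longrightarrow> dl l x y = dl l y x"
  using metric[of l] unfolding two_sided_inv_metric_def by blast

lemma dl_triangle:
  "x \<in> carrier (G l) \<Longrightarrow> y \<in> carrier (G l) \<Longrightarrow> z \<in> carrier (G l) \<Longrightarrow> dl l x z \<le> dl l x y + dl l y z"
  using metric[of l] unfolding two_sided_inv_metric_def by blast

lemma dl_left [simp]:
  "g \<in> carrier (G l) \<Longrightarrow> x \<in> carrier (G l) \<Longrightarrow> y \<in> carrier (G l) \<Longrightarrow>
     dl l (g \<otimes>\<^bsub>G l\<^esub> x) (g \<otimes>\<^bsub>G l\<^esub> y) = dl l x y"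
  using metric[of l] unfolding two_sided_inv_metric_def by blast

lemma dl_right [simp]:
  "g \<in> carrier (G l) \<Longrightarrow> x \<in> carrier (G l) \<Longrightarrow> y \<in> carrier (G l) \<Longrightarrow>
     dl l (x \<otimes>\<^bsub>G l\<^esub> g) (y \<otimes>\<^bsub>G l\<^esub> g) = dl l x y"
  using metric[of l] unfolding two_sided_inv_metric_def by blast

lemma dl_mult:
  assumes "x \<in> carrier (G l)" "y \<in> carrier (G l)" "x' \<in> carrier (G l)" "y' \<in> carrier (G l)"
  shows "dl l (x \<otimes>\<^bsub>G l\<^esub> y) (x' \<otimes>\<^bsub>G l\<^esub> y') \<le> dl l x x' + dl l y y'"
  using dl_triangle[of "x \<otimes>\<^bsub>G l\<^esub> y" l "x' \<otimes>\<^bsub>G l\<^esub> y" "x' \<otimes>\<^bsub>G l\<^esub> y'"] assms by simp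

text \<open>Invariance moves a factor of a product to the other argument; this makes splitting a
  letter free of cost.\<close>

lemma dl_shift:
  assumes "x \<in> carrier (G l)" "y \<in> carrier (G l)" "z \<in> carrier (G l)"
  shows "dl l y (inv\<^bsub>G l\<^esub> x \<otimes>\<^bsub>G l\<^esub> z) = dl l (x \<otimes>\<^bsub>G l\<^esub> y) z"
    "dl l x (z \<otimes>\<^bsub>G l\<^esub> inv\<^bsub>G l\<^esub> y) = dl l (x \<otimes>\<^bsub>G l\<^esub> y) z"
  using dl_left[of x l y "inv\<^bsub>G l\<^esub> x \<otimes>\<^bsub>G l\<^esub> z"] dl_right[of y l x "z \<otimes>\<^bsub>G l\<^esub> inv\<^bsub>G l\<^esub> y"] assms
  by simp_all

lemma dl_inv:
  assumes "x \<in> carrier (G l)" "y \<in> carrier (G l)"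
  shows "dl l (inv\<^bsub>G l\<^esub> x) (inv\<^bsub>G l\<^esub> y) = dl l x y"
proof -
  have "dl l (inv\<^bsub>G l\<^esub> x) (inv\<^bsub>G l\<^esub> y) = dl l \<one>\<^bsub>G l\<^esub> (x \<otimes>\<^bsub>G l\<^esub> inv\<^bsub>G l\<^esub> y)"
    using dl_left[of x l "inv\<^bsub>G l\<^esub> x" "inv\<^bsub>G l\<^esub> y"] assms by simp
  also have "\<dots> = dl l y x"
    using dl_right[of "inv\<^bsub>G l\<^esub> y" l y x] assms by simp
  also have "\<dots> = dl l x y" using assms dl_sym by blast
  finally show ?thesis .
qed

section \<open>Trivial words as witnesses, and their cost\<close>

abbreviation fits :: "('i \<times> 'a) list \<Rightarrow> 'a list \<Rightarrow> bool" where
  "fits \<equiv> list_all2 (\<lambda>(l, _) z. z \<in> carrier (G l))"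

definition cost :: "('i \<times> 'a) list \<Rightarrow> 'a list \<Rightarrow> real" where
  "cost w zs = sum_list (map2 (\<lambda>(l, x) z. dl l x z) w zs)"

text \<open>A predicate in \<open>r\<close> takes the place of the infimum of the costs, so that
  changes of the word can be treated witness by witness.\<close>

definition near :: "('i \<times> 'a) list \<Rightarrow> real \<Rightarrow> bool" where
  "near w r \<longleftrightarrow> (\<exists>zs. fits w zs \<and> (zs, []) \<in> amal_eq G \<and> cost w zs \<le> r)"

lemma nearI: "fits w zs \<Longrightarrow> (zs, []) \<in> amal_eq G \<Longrightarrow> cost w zs \<le> r \<Longrightarrow> near w r"
  unfolding near_def by blast

lemma cost_simps [simp]:
  "cost [] zs = 0" "cost ((l, x) # w) (z # zs) = dl l x z + cost w zs"
  by (simp_all add: cost_def)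

lemma cost_append [simp]:
  "length u = length us \<Longrightarrow> cost (u @ v) (us @ vs) = cost u us + cost v vs"
  by (simp add: cost_def)

lemma fits_length: "fits w zs \<Longrightarrow> length w = length zs"
  by (rule list_all2_lengthD)

lemma fits_words [simp]: "fits w zs \<Longrightarrow> zs \<in> words G"
  by (induction rule: list_all2_induct) auto

lemma near_appendE:
  assumes "near (u @ v) r"
  obtains us vs where "fits u us" "fits v vs" "(us @ vs, []) \<in> amal_eq G" "cost u us + cost v vs \<le> r"
proof -
  obtain zs where "fits (u @ v) zs" "(zs, []) \<in> amal_eq G" "cost (u @ v) zs \<le> r"
    using assms unfolding near_def by blast
  moreover from this obtain us vs where "zs = us @ vs" "length us = length u" "fits u us" "fits v vs"
    by (auto simp: list_all2_append1)
  ultimately show thesis using that by simp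
qed

lemma nearE:
  assumes "near (u @ (l, x) # v) r"
  obtains us z vs where "fits u us" "z \<in> carrier (G l)" "fits v vs"
    "(us @ z # vs, []) \<in> amal_eq G" "cost u us + dl l x z + cost v vs \<le> r"
proof -
  obtain us vs' where *: "fits u us" "fits ((l, x) # v) vs'" "(us @ vs', []) \<in> amal_eq G"
    "cost u us + cost ((l, x) # v) vs' \<le> r"
    using near_appendE[OF assms] .
  then obtain z vs where "vs' = z # vs" "z \<in> carrier (G l)" "fits v vs"
    by (auto simp: list_all2_Cons1)
  then show thesis using that * by simp
qed

text \<open>If \<open>z\<close> matches the product, then \<open>x\<close> is matched with itself
  and \<open>y\<close> with the remaining factor of \<open>z\<close>, at the same cost by
  \<open>dl_shift\<close>. The label of \<open>x\<close> may be any factor containing it.\<close>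

lemma near_splitL:
  assumes "near (u @ (k, x \<otimes>\<^bsub>G k\<^esub> y) # v) r" "x \<in> carrier (G k)" "x \<in> carrier (G m)"
    "y \<in> carrier (G k)"
  shows "near (u @ (m, x) # (k, y) # v) r"
proof -
  obtain us z vs where *: "fits u us" "z \<in> carrier (G k)" "fits v vs"
    "(us @ z # vs, []) \<in> amal_eq G" "cost u us + dl k (x \<otimes>\<^bsub>G k\<^esub> y) z + cost v vs \<le> r"
    using nearE[OF assms(1)] .
  show ?thesis
  proof (rule nearI)
    show "(us @ x # (inv\<^bsub>G k\<^esub> x \<otimes>\<^bsub>G k\<^esub> z) # vs, []) \<in> amal_eq G"
      using amal_eq_mult[of x k "inv\<^bsub>G k\<^esub> x \<otimes>\<^bsub>G k\<^esub> z" us vs] * assms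
      by (intro amal_eq_trans[OF _ *(4)]) auto
  qed (use * assms fits_length[OF *(1)] dl_shift(1)[of x k y z] in
      \<open>auto intro: list_all2_appendI\<close>)
qed

text \<open>Mirror image of \<open>near_splitL\<close>: here \<open>y\<close> is matched with
  itself.\<close>

lemma near_splitR:
  assumes "near (u @ (m, x \<otimes>\<^bsub>G m\<^esub> y) # v) r" "x \<in> carrier (G m)" "y \<in> carrier (G m)"
    "y \<in> carrier (G k)"
  shows "near (u @ (m, x) # (k, y) # v) r"
proof -
  obtain us z vs where *: "fits u us" "z \<in> carrier (G m)" "fits v vs"
    "(us @ z # vs, []) \<in> amal_eq G" "cost u us + dl m (x \<otimes>\<^bsub>G m\<^esub> y) z + cost v vs \<le> r"
    using nearE[OF assms(1)] .
  show ?thesis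
  proof (rule nearI)
    show "(us @ (z \<otimes>\<^bsub>G m\<^esub> inv\<^bsub>G m\<^esub> y) # y # vs, []) \<in> amal_eq G"
      using amal_eq_mult[of "z \<otimes>\<^bsub>G m\<^esub> inv\<^bsub>G m\<^esub> y" m y us vs] * assms
      by (intro amal_eq_trans[OF _ *(4)]) auto
  qed (use * assms fits_length[OF *(1)] dl_shift(2)[of x m y z] in
      \<open>auto intro: list_all2_appendI\<close>)
qed

text \<open>The two matched letters are multiplied as well; \<open>dl_mult\<close> bounds the new
  cost.\<close>

lemma near_merge:
  assumes "near (u @ (l, x) # (l, y) # v) r" "x \<in> carrier (G l)" "y \<in> carrier (G l)"
  shows "near (u @ (l, x \<otimes>\<^bsub>G l\<^esub> y) # v) r"
proof -
  obtain us z vs' where *: "fits u us" "z \<in> carrier (G l)" "fits ((l, y) # v) vs'"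
    "(us @ z # vs', []) \<in> amal_eq G" "cost u us + dl l x z + cost ((l, y) # v) vs' \<le> r"
    using nearE[OF assms(1)] .
  then obtain z' vs where vs: "vs' = z' # vs" "z' \<in> carrier (G l)" "fits v vs"
    by (auto simp: list_all2_Cons1)
  show ?thesis
  proof (rule nearI)
    show "(us @ (z \<otimes>\<^bsub>G l\<^esub> z') # vs, []) \<in> amal_eq G"
      by (rule amal_eq_trans_sym[of "us @ z # z' # vs"]) (use amal_eq_mult * vs in auto)
  qed (use * vs assms fits_length[OF *(1)] dl_mult[of x l y z z'] in
      \<open>auto intro: list_all2_appendI\<close>)
qed

lemma near_insert_one:
  assumes "near (u @ v) r"
  shows "near (u @ (l, \<one>\<^bsub>G l\<^esub>) # v) r"
proof -
  obtain us vs where *: "fits u us" "fits v vs" "(us @ vs, []) \<in> amal_eq G"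
    "cost u us + cost v vs \<le> r"
    using near_appendE[OF assms] .
  show ?thesis
  proof (rule nearI)
    show "(us @ \<one>\<^bsub>G l\<^esub> # vs, []) \<in> amal_eq G"
      by (rule amal_eq_trans[of _ "us @ vs"]) (use amal_eq_one * in auto)
  qed (use * fits_length[OF *(1)] in \<open>auto intro: list_all2_appendI\<close>)
qed

text \<open>Reads a witness as a labelled word with the labels of \<open>w\<close>, so that it can
  be corrected in turn.\<close>

lemma fits_zip:
  assumes "fits w zs"
  shows "labelled (zip (map fst w) zs)" "map snd (zip (map fst w) zs) = zs"
    "map fst (zip (map fst w) zs) = map fst w"
    "fits (zip (map fst w) zs) vs \<longleftrightarrow> fits w vs"
proof -
  show "labelled (zip (map fst w) zs)"
    using assms by (induction rule: list_all2_induct) auto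
  show "map snd (zip (map fst w) zs) = zs" "map fst (zip (map fst w) zs) = map fst w"
    using fits_length[OF assms] by simp_all
  show "fits (zip (map fst w) zs) vs \<longleftrightarrow> fits w vs"
    using assms by (induction arbitrary: vs rule: list_all2_induct) (auto simp: list_all2_Cons1)
qed

text \<open>Bounds the cost of a witness that is reached through an intermediate word.\<close>

lemma cost_triangle:
  assumes "labelled w" "fits w zs" "fits w vs"
  shows "cost w vs \<le> cost w zs + cost (zip (map fst w) zs) vs"
  using assms(2,1,3)
proof (induction arbitrary: vs rule: list_all2_induct)
  case (Cons p w z zs)
  obtain l x where p: "p = (l, x)" by force
  from Cons p obtain v vs' where vs: "vs = v # vs'" "v \<in> carrier (G l)" "fits w vs'"
    by (auto simp: list_all2_Cons1)
  then have "cost w vs' \<le> cost w zs + cost (zip (map fst w) zs) vs'"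
    using Cons.IH[of vs'] Cons.prems p by simp
  then show ?case
    using Cons.hyps Cons.prems p vs dl_triangle[of x l z v] by simp
qed simp

text \<open>By \<open>labelled_induct\<close>. A one-letter word is \<open>g\<close> itself, perhaps
  with another label, but then \<open>g\<close> is in \<open>A\<close> and the metrics agree. A
  reduced word of length at least 2 cannot represent a letter. In the merging cases the witness for
  the shorter word is split without cost.\<close>

lemma near_if_in_factor:
  assumes "labelled w" "g \<in> carrier (G l)" "(map snd w, [g]) \<in> amal_eq G"
  shows "near w (dl l g \<one>\<^bsub>G l\<^esub>)"
  using assms(1,3)
proof (induction rule: labelled_induct)
  case Nil
  then show ?case using assms by (intro nearI[of _ "[]"]) simp_all
next
  case (single m x)
  then have "x = g" using amal_eq_single[of x g] assms by simp
  moreover have "dl m g \<one>\<^bsub>G m\<^esub> = dl l g \<one>\<^bsub>G l\<^esub>"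
  proof (cases "l = m")
    case False
    then have "g \<in> A" using in_A_if_two_factors single assms \<open>x = g\<close> by blast
    then show ?thesis using A_metric[of g "\<one>\<^bsub>G l\<^esub>" m l] one_eq[of m l] by simp
  qed simp
  ultimately show ?case
    using amal_eq_one[of "[]" "[]" m] by (intro nearI[of _ "[\<one>\<^bsub>G m\<^esub>]"]) simp_all
next
  case (reduced w)
  then show ?case using reduced_single[of w g] assms by simp
next
  case (mergeL u m x k y v)
  then have "(map snd u @ (x \<otimes>\<^bsub>G k\<^esub> y) # map snd v, [g]) \<in> amal_eq G"
    using amal_eq_mult[of x k y "map snd u" "map snd v"] labelled_words[of u] labelled_words[of v]
      amal_eq_trans_sym[OF _ mergeL.prems]
    by (simp add: words_def)
  then have "near (u @ (k, x \<otimes>\<^bsub>G k\<^esub> y) # v) (dl l g \<one>\<^bsub>G l\<^esub>)"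
    using mergeL.IH by simp
  then show ?case by (rule near_splitL) (use mergeL.hyps in auto)
next
  case (mergeR u m x k y v)
  then have "(map snd u @ (x \<otimes>\<^bsub>G m\<^esub> y) # map snd v, [g]) \<in> amal_eq G"
    using amal_eq_mult[of x m y "map snd u" "map snd v"] labelled_words[of u] labelled_words[of v]
      amal_eq_trans_sym[OF _ mergeR.prems]
    by (simp add: words_def)
  then have "near (u @ (m, x \<otimes>\<^bsub>G m\<^esub> y) # v) (dl l g \<one>\<^bsub>G l\<^esub>)"
    using mergeR.IH by simp
  then show ?case by (rule near_splitR) (use mergeR.hyps in auto)
qed

text \<open>Deleting an identity letter that is matched with \<open>z\<close>: after rotation the remaining letters of
  the trivial word multiply to the inverse of \<open>z\<close>, so they can be corrected at the cost already paid
  for \<open>z\<close>.\<close>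

lemma near_delete_one:
  assumes "near (u @ (l, \<one>\<^bsub>G l\<^esub>) # v) r" "labelled u" "labelled v"
  shows "near (u @ v) r"
proof -
  obtain us z vs where *: "fits u us" "z \<in> carrier (G l)" "fits v vs"
    "(us @ z # vs, []) \<in> amal_eq G" "cost u us + dl l \<one>\<^bsub>G l\<^esub> z + cost v vs \<le> r"
    using nearE[OF assms(1)] .
  let ?g = "inv\<^bsub>G l\<^esub> z"
  have "(z # vs @ us, []) \<in> amal_eq G"
    using amal_eq_rotate[of us "z # vs"] * by simp
  moreover have "([z, ?g], []) \<in> amal_eq G"
    using linv_cancel(1)[of z "[]" "[]"] * linv_eq by simp
  ultimately have "(z # vs @ us, [z, ?g]) \<in> amal_eq G"
    by (rule amal_eq_trans[OF _ amal_eq_sym])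
  then have "([z] @ vs @ us, [z] @ [?g]) \<in> amal_eq G" by simp
  then have "(vs @ us, [?g]) \<in> amal_eq G"
    by (rule amal_eq_cancel_left) (use * carrier_alphabet[of ?g l] in auto)
  \<comment> \<open>The result for words that represent a letter is applied to the old witness, read
    with the labels of \<open>v\<close> and \<open>u\<close>, and not to the given word.\<close>
  then have "near (zip (map fst v) vs @ zip (map fst u) us) (dl l ?g \<one>\<^bsub>G l\<^esub>)"
    using fits_zip * by (intro near_if_in_factor) auto
  then obtain vs' us' where zip: "fits (zip (map fst v) vs) vs'" "fits (zip (map fst u) us) us'"
    and triv: "(vs' @ us', []) \<in> amal_eq G"
    and c: "cost (zip (map fst v) vs) vs' + cost (zip (map fst u) us) us' \<le> dl l ?g \<one>\<^bsub>G l\<^esub>"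
    by (rule near_appendE)
  have fits: "fits v vs'" "fits u us'" using zip fits_zip * by auto
  have "dl l ?g \<one>\<^bsub>G l\<^esub> = dl l \<one>\<^bsub>G l\<^esub> z"
    using dl_left[of z l ?g "\<one>\<^bsub>G l\<^esub>"] * by simp
  \<comment> \<open>The correction costs what the deleted letter had cost, so the total does not
    grow.\<close>
  then have "cost u us' + cost v vs' \<le> r"
    using c * cost_triangle[OF assms(2) *(1) fits(2)] cost_triangle[OF assms(3) *(3) fits(1)] by simp
  then show ?thesis
    using amal_eq_rotate[OF triv] fits fits_length[OF fits(2)]
    by (intro nearI[of _ "us' @ vs'"]) (auto intro: list_all2_appendI)
qed

text \<open>A letter \<open>x\<close> with two possible labels lies in \<open>A\<close>. Splitting
  it as identity times \<open>x\<close> leaves the old label on the identity and lets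
  \<open>x\<close> take the new one; the identity is then deleted.\<close>

lemma near_relabel:
  assumes "near (u @ w) r" "labelled u" "labelled w" "labelled w'" "map snd w = map snd w'"
  shows "near (u @ w') r"
  using assms
proof (induction w arbitrary: u w')
  case (Cons p w)
  obtain l m x v where p: "p = (l, x)" "w' = (m, x) # v" "map snd w = map snd v"
    using Cons.prems by (cases p) auto
  have "near (u @ (m, x) # w) r"
  proof (cases "l = m")
    case False
    then have "x \<in> A" using Cons.prems p in_A_if_two_factors by auto
    then have "near (u @ (l, \<one>\<^bsub>G l\<^esub>) # (m, x) # w) r"
      using near_splitR[of u l "\<one>\<^bsub>G l\<^esub>" x w r m] Cons.prems p by simp
    then show ?thesis using near_delete_one Cons.prems p by simp
  qed (use Cons.prems p in simp)
  then show ?case using Cons.IH[of "u @ [(m, x)]" v] Cons.prems p by simp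
qed simp

lemma near_relabel_iff:
  assumes "labelled v" "labelled w" "map snd v = map snd w"
  shows "near v r \<longleftrightarrow> near w r"
  using near_relabel[of "[]" v r w] near_relabel[of "[]" w r v] assms by auto

section \<open>Independence of the representing word\<close>

definition lab :: "'a list \<Rightarrow> ('i \<times> 'a) list" where
  "lab w = map (\<lambda>x. (SOME l. x \<in> carrier (G l), x)) w"

lemma lab_labelled: "w \<in> words G \<Longrightarrow> labelled (lab w)"
  unfolding lab_def labelled_def words_def alphabet_def by (auto intro: someI)

lemma map_snd_lab: "map snd (lab w) = w"
  by (simp add: lab_def comp_def)

lemma near_step:
  assumes "(w, w') \<in> amal_step G" "labelled v" "labelled v'" "map snd v = w" "map snd v' = w'"
  shows "near v r \<longleftrightarrow> near v' r"
proof -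
  from assms show ?thesis
  proof (induction rule: amal_step.induct)
    case (mult x l y p q)
    then have "p \<in> words G" "q \<in> words G" by (auto simp: words_def)
    note * = this[THEN lab_labelled]
    \<comment> \<open>Relabelling puts both letters into the factor \<open>l\<close> in which the
      reduction multiplies them, as \<open>near_merge\<close> requires equal labels.\<close>
    have "near v r \<longleftrightarrow> near (lab p @ (l, x) # (l, y) # lab q) r"
      by (rule near_relabel_iff) (use mult * in \<open>auto simp: map_snd_lab\<close>)
    also have "\<dots> \<longleftrightarrow> near (lab p @ (l, x \<otimes>\<^bsub>G l\<^esub> y) # lab q) r"
      using near_merge near_splitL[of "lab p" l x y "lab q" r l] mult by blast
    also have "\<dots> \<longleftrightarrow> near v' r"
      by (rule near_relabel_iff) (use mult * in \<open>auto simp: map_snd_lab\<close>)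
    finally show ?case .
  next
    case (unit p q l)
    then have "p \<in> words G" "q \<in> words G" by (auto simp: words_def)
    note * = this[THEN lab_labelled]
    have "near v r \<longleftrightarrow> near (lab p @ (l, \<one>\<^bsub>G l\<^esub>) # lab q) r"
      by (rule near_relabel_iff) (use unit * in \<open>auto simp: map_snd_lab\<close>)
    also have "\<dots> \<longleftrightarrow> near (lab p @ lab q) r"
      using near_delete_one near_insert_one * by blast
    also have "\<dots> \<longleftrightarrow> near v' r"
      by (rule near_relabel_iff) (use unit * in \<open>auto simp: map_snd_lab\<close>)
    finally show ?case .
  qed
qed

text \<open>Follows the chain of reductions, with arbitrary labels on the words in between. This is
  the invariance that lets distances be read off from a convenient representative.\<close>

lemma near_cong:
  assumes "(w, w') \<in> amal_eq G" "labelled v" "labelled v'" "map snd v = w" "map snd v' = w'"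
  shows "near v r \<longleftrightarrow> near v' r"
  using assms unfolding amal_eq_def
proof (induction arbitrary: v' rule: rtrancl_induct)
  case base
  then show ?case by (intro near_relabel_iff) simp_all
next
  case (step y z)
  then have y: "labelled (lab y)" using amal_step_words[of y z] amal_step_words[of z y] lab_labelled by blast
  then have "near v r \<longleftrightarrow> near (lab y) r" using step.IH step.prems map_snd_lab by blast
  also have "\<dots> \<longleftrightarrow> near v' r"
    using step.hyps(2) near_step[of y z "lab y" v'] near_step[of z y v' "lab y"] step.prems y map_snd_lab
    by auto
  finally show ?case .
qed

section \<open>The Graev metric\<close>

abbreviation d :: "'a \<Rightarrow> 'a \<Rightarrow> real" where
  "d \<equiv> amal_metric G A dl"

abbreviation D :: "'a list \<Rightarrow> 'a list \<Rightarrow> real" where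
  "D \<equiv> graev_amal G A dl"

text \<open>The choice of a common factor is harmless: two different ones force both points into
  \<open>A\<close>, where the metrics agree.\<close>

lemma d_common:
  assumes "x \<in> carrier (G l)" "y \<in> carrier (G l)"
  shows "d x y = dl l x y"
proof -
  define m where "m = (SOME l. x \<in> carrier (G l) \<and> y \<in> carrier (G l))"
  have m: "x \<in> carrier (G m)" "y \<in> carrier (G m)"
    unfolding m_def using assms by (metis (mono_tags, lifting) someI_ex)+
  have "d x y = dl m x y"
    using assms by (auto simp: amal_metric_def m_def)
  also have "\<dots> = dl l x y"
  proof (cases "m = l")
    case False
    then have "x \<in> A" "y \<in> A" using m assms in_A_if_two_factors by blast+
    then show ?thesis by (rule A_metric)
  qed simp
  finally show ?thesis .
qed

abbreviation detours :: "'a \<Rightarrow> 'a \<Rightarrow> real set" where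
  "detours x y \<equiv> {dl l1 x a + dl l2 a y | a l1 l2.
     a \<in> A \<and> x \<in> carrier (G l1) \<and> y \<in> carrier (G l2)}"

lemma d_not_common:
  assumes "\<nexists>l. x \<in> carrier (G l) \<and> y \<in> carrier (G l)"
  shows "d x y = Inf (detours x y)"
  using assms unfolding amal_metric_def by (simp only: if_False)

lemma detours_nonempty: "x \<in> alphabet G \<Longrightarrow> y \<in> alphabet G \<Longrightarrow> detours x y \<noteq> {}"
  unfolding alphabet_def using A_closed(2) by blast

lemma detours_nonneg: "r \<in> detours x y \<Longrightarrow> 0 \<le> r"
  by (auto intro: add_nonneg_nonneg)

lemma d_nonneg:
  assumes "x \<in> alphabet G" "y \<in> alphabet G"
  shows "0 \<le> d x y"
proof (cases "\<exists>l. x \<in> carrier (G l) \<and> y \<in> carrier (G l)")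
  case True
  then show ?thesis using d_common by auto
next
  case False
  then show ?thesis
    unfolding d_not_common[OF False] using detours_nonempty[OF assms] detours_nonneg
    by (intro cInf_greatest)
qed

lemma d_self: "x \<in> alphabet G \<Longrightarrow> d x x = 0"
  using d_common by (auto simp: alphabet_def)

lemma d_sym: "d x y = d y x"
proof (cases "\<exists>l. x \<in> carrier (G l) \<and> y \<in> carrier (G l)")
  case True
  then obtain l where "x \<in> carrier (G l)" "y \<in> carrier (G l)" by blast
  then show ?thesis using d_common[of x l y] d_common[of y l x] dl_sym[of x l y] by simp
next
  case False
  have "detours x y \<subseteq> detours y x" for x y
  proof
    fix r assume "r \<in> detours x y"
    then obtain a l1 l2 where "r = dl l1 x a + dl l2 a y" "a \<in> A"
      "x \<in> carrier (G l1)" "y \<in> carrier (G l2)"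
      by blast
    then have "r = dl l2 y a + dl l1 a x" using dl_sym[of x l1 a] dl_sym[of a l2 y] by simp
    with \<open>a \<in> A\<close> \<open>x \<in> _\<close> \<open>y \<in> _\<close> show "r \<in> detours y x" by blast
  qed
  then have "detours x y = detours y x" by blast
  moreover have "\<nexists>l. y \<in> carrier (G l) \<and> x \<in> carrier (G l)" using False by blast
  ultimately show ?thesis unfolding d_not_common[OF False] by (subst d_not_common) simp_all
qed

text \<open>Letters without a common factor are matched through a nearly optimal
  \<open>a \<in> A\<close>: \<open>x\<close> is written as \<open>x\<close> times the identity and
  \<open>y\<close> as \<open>a\<close> times the rest, and each pair then lies in one
  factor.\<close>

lemma letter_approx:
  assumes "x \<in> alphabet G" "y \<in> alphabet G" "e > 0"
  obtains w zs where "labelled w" "fits w zs" "(map snd w, [x]) \<in> amal_eq G" "(zs, [y]) \<in> amal_eq G"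
    "cost w zs < d x y + e"
proof (cases "\<exists>l. x \<in> carrier (G l) \<and> y \<in> carrier (G l)")
  case True
  then obtain l where l: "x \<in> carrier (G l)" "y \<in> carrier (G l)" by blast
  show thesis by (rule that[of "[(l, x)]" "[y]"]) (use l assms d_common in auto)
next
  case False
  have "Inf (detours x y) < d x y + e" using d_not_common[OF False] assms by simp
  then obtain a l m where a: "a \<in> A" "x \<in> carrier (G l)" "y \<in> carrier (G m)"
    "dl l x a + dl m a y < d x y + e"
    using cInf_lessD[OF detours_nonempty[OF assms(1,2)]] by blast
  show thesis
  proof (rule that)
    show "labelled [(l, x), (m, \<one>\<^bsub>G m\<^esub>)]" using a by simp
    show "fits [(l, x), (m, \<one>\<^bsub>G m\<^esub>)] [a, inv\<^bsub>G m\<^esub> a \<otimes>\<^bsub>G m\<^esub> y]" using a by simp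
    show "(map snd [(l, x), (m, \<one>\<^bsub>G m\<^esub>)], [x]) \<in> amal_eq G"
      using amal_eq_one[of "[x]" "[]" m] assms by simp
    show "([a, inv\<^bsub>G m\<^esub> a \<otimes>\<^bsub>G m\<^esub> y], [y]) \<in> amal_eq G"
      using amal_eq_mult[of a m "inv\<^bsub>G m\<^esub> a \<otimes>\<^bsub>G m\<^esub> y" "[]" "[]"] a by simp
    show "cost [(l, x), (m, \<one>\<^bsub>G m\<^esub>)] [a, inv\<^bsub>G m\<^esub> a \<otimes>\<^bsub>G m\<^esub> y] < d x y + e"
      using a dl_shift(1)[of a m "\<one>\<^bsub>G m\<^esub>" y] by simp
  qed
qed

section \<open>Word distances and their approximation by costs\<close>

lemma word_dist_simps [simp]:
  "word_dist f [] v = 0" "word_dist f (x # u) (y # v) = f x y + word_dist f u v"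
  "length u = length u' \<Longrightarrow> word_dist f (u @ v) (u' @ v') = word_dist f u u' + word_dist f v v'"
  by (simp_all add: word_dist_def)

text \<open>Concatenates the approximations of the letters, halving the error at each one;
  \<open>w\<close> may be longer than \<open>u\<close>.\<close>

lemma word_approx:
  assumes "length u = length v" "u \<in> words G" "v \<in> words G" "e > 0"
  shows "\<exists>w zs. labelled w \<and> fits w zs \<and> (map snd w, u) \<in> amal_eq G \<and> (zs, v) \<in> amal_eq G \<and>
    cost w zs < word_dist d u v + e"
  using assms
proof (induction u v arbitrary: e rule: list_induct2)
  case Nil
  then show ?case by (intro exI[of _ "[]"]) simp
next
  case (Cons x u y v)
  obtain w zs where 1: "labelled w" "fits w zs" "(map snd w, [x]) \<in> amal_eq G"
    "(zs, [y]) \<in> amal_eq G" "cost w zs < d x y + e / 2"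
    using letter_approx[of x y "e / 2"] Cons.prems by auto
  obtain w' zs' where 2: "labelled w'" "fits w' zs'" "(map snd w', u) \<in> amal_eq G"
    "(zs', v) \<in> amal_eq G" "cost w' zs' < word_dist d u v + e / 2"
    using Cons.IH[of "e / 2"] Cons.prems by auto
  have "(map snd w @ map snd w', [x] @ u) \<in> amal_eq G"
    by (rule amal_eq_append) (use 1 2 Cons.prems labelled_words[OF 2(1)] in \<open>auto simp: words_def\<close>)
  moreover have "(zs @ zs', [y] @ v) \<in> amal_eq G"
    by (rule amal_eq_append) (use 1 2 Cons.prems in auto)
  moreover have "fits (w @ w') (zs @ zs')"
    using 1 2 by (intro list_all2_appendI)
  moreover have "cost (w @ w') (zs @ zs') < word_dist d (x # u) (y # v) + e"
    using 1 2 fits_length[OF 1(2)] by simp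
  ultimately show ?case using 1 2 by (intro exI[of _ "w @ w'"] exI[of _ "zs @ zs'"]) simp
qed

lemma word_dist_nonneg:
  "length u = length v \<Longrightarrow> u \<in> words G \<Longrightarrow> v \<in> words G \<Longrightarrow> 0 \<le> word_dist d u v"
  by (induction u v rule: list_induct2) (auto simp: d_nonneg)

lemma word_dist_self [simp]: "w \<in> words G \<Longrightarrow> word_dist d w w = 0"
  by (induction w) (auto simp: d_self)

lemma word_dist_sym: "length u = length v \<Longrightarrow> word_dist d u v = word_dist d v u"
  by (induction u v rule: list_induct2) (auto simp: d_sym)

section \<open>Pseudometric properties and invariance of the Graev distance\<close>

definition aligned :: "'a list \<Rightarrow> 'a list \<Rightarrow> 'a list \<Rightarrow> 'a list \<Rightarrow> bool" where
  "aligned f1 f2 u v \<longleftrightarrow> u \<in> words G \<and> v \<in> words G \<and> u \<noteq> [] \<and> length u = length v \<and>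
     (u, f1) \<in> amal_eq G \<and> (v, f2) \<in> amal_eq G"

lemma D_eq: "D f1 f2 = Inf {word_dist d u v | u v. aligned f1 f2 u v}"
  unfolding graev_amal_def aligned_def ..

lemma ex_aligned:
  assumes "f1 \<in> words G" "f2 \<in> words G"
  shows "\<exists>u v. aligned f1 f2 u v"
proof -
  let ?ones = "\<lambda>n. replicate n \<one>\<^bsub>G undefined\<^esub>"
  have one: "\<one>\<^bsub>G undefined\<^esub> \<in> alphabet G"
    by (rule carrier_alphabet[of _ undefined]) simp
  have ones: "?ones n \<in> words G" for n
    using one by (auto simp: words_def)
  have "(f @ ?ones n, f) \<in> amal_eq G" if "f \<in> words G" for f n
  proof (induction n)
    case (Suc n)
    show ?case
      using amal_eq_trans[OF amal_eq_one[of f "?ones n" undefined] Suc] that ones by simp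
  qed simp
  \<comment> \<open>Padding with identities makes the lengths equal; the extra one from
    \<open>Suc\<close> keeps the words nonempty when \<open>f1\<close> and \<open>f2\<close> both
    are empty.\<close>
  then have "aligned f1 f2 (f1 @ ?ones (Suc (length f2))) (f2 @ ?ones (Suc (length f1)))"
    unfolding aligned_def using assms ones one by (simp del: replicate_Suc)
  then show ?thesis by blast
qed

lemma D_le: "aligned f1 f2 u v \<Longrightarrow> D f1 f2 \<le> word_dist d u v"
  unfolding D_eq
  by (rule cInf_lower) (auto simp: aligned_def intro!: bdd_belowI[of _ 0] word_dist_nonneg)

lemma D_greatest:
  assumes "f1 \<in> words G" "f2 \<in> words G" "\<And>u v. aligned f1 f2 u v \<Longrightarrow> r \<le> word_dist d u v"
  shows "r \<le> D f1 f2"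
  unfolding D_eq by (rule cInf_greatest) (use ex_aligned assms in auto)

lemma D_lessE:
  assumes "f1 \<in> words G" "f2 \<in> words G" "D f1 f2 < r"
  obtains u v where "aligned f1 f2 u v" "word_dist d u v < r"
  using D_greatest[OF assms(1,2), of r] assms(3) by force

lemma D_nonneg: "f1 \<in> words G \<Longrightarrow> f2 \<in> words G \<Longrightarrow> 0 \<le> D f1 f2"
  by (rule D_greatest) (auto simp: aligned_def intro: word_dist_nonneg)

lemma D_cong:
  assumes "(f1, f1') \<in> amal_eq G" "(f2, f2') \<in> amal_eq G"
  shows "D f1 f2 = D f1' f2'"
proof -
  have "(u, f) \<in> amal_eq G \<longleftrightarrow> (u, f') \<in> amal_eq G" if "(f, f') \<in> amal_eq G" for u f f'
    using that amal_eq_trans amal_eq_sym by blast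
  then have "aligned f1 f2 = aligned f1' f2'"
    unfolding aligned_def using assms by (intro ext) simp
  then show ?thesis by (simp add: D_eq)
qed

lemma D_sym:
  assumes "f1 \<in> words G" "f2 \<in> words G"
  shows "D f1 f2 = D f2 f1"
proof -
  have "D f2 f1 \<le> D f1 f2" if "f1 \<in> words G" "f2 \<in> words G" for f1 f2
  proof (rule D_greatest)
    fix u v assume "aligned f1 f2 u v"
    then have "aligned f2 f1 v u" "word_dist d u v = word_dist d v u"
      by (auto simp: aligned_def intro: word_dist_sym)
    then show "D f2 f1 \<le> word_dist d u v" using D_le by simp
  qed (use that in auto)
  then show ?thesis using assms by (meson antisym)
qed

text \<open>The words \<open>v\<close> and \<open>v'\<close> for \<open>f2\<close> may have
  different lengths. Inserting the inverse of \<open>v'\<close> in the middle, matched with itself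
  at no cost, aligns \<open>u\<close> with \<open>v\<close> and \<open>v'\<close> with
  \<open>w\<close>.\<close>

lemma D_triangle:
  assumes "f1 \<in> words G" "f2 \<in> words G" "f3 \<in> words G"
  shows "D f1 f3 \<le> D f1 f2 + D f2 f3"
proof -
  have *: "D f1 f3 \<le> word_dist d u v + word_dist d v' w"
    if uv: "aligned f1 f2 u v" and vw: "aligned f2 f3 v' w" for u v v' w
  proof -
    have words: "u \<in> words G" "v \<in> words G" "v' \<in> words G" "w \<in> words G"
      and eqs: "(u, f1) \<in> amal_eq G" "(v, v') \<in> amal_eq G" "(w, f3) \<in> amal_eq G"
      using uv vw amal_eq_trans[of v f2 v'] amal_eq_sym[of v' f2] by (simp_all add: aligned_def)
    have "(u @ winv v' @ v', u) \<in> amal_eq G"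
      using amal_eq_cong[OF winv_cancel(2)[of v'], of u "[]"] words by simp
    then have 1: "(u @ winv v' @ v', f1) \<in> amal_eq G" using eqs(1) by (rule amal_eq_trans)
    have "(v @ winv v' @ w, v' @ winv v' @ w) \<in> amal_eq G"
      using amal_eq_cong[OF eqs(2), of "[]" "winv v' @ w"] words by simp
    moreover have "(v' @ winv v' @ w, w) \<in> amal_eq G"
      using amal_eq_cong[OF winv_cancel(1)[of v'], of "[]" w] words by simp
    ultimately have "(v @ winv v' @ w, f3) \<in> amal_eq G"
      using eqs(3) amal_eq_trans by blast
    with 1 have "aligned f1 f3 (u @ winv v' @ v') (v @ winv v' @ w)"
      using uv vw words by (auto simp: aligned_def)
    then show ?thesis
      using D_le[of f1 f3 "u @ winv v' @ v'" "v @ winv v' @ w"] uv vw words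
      by (simp add: aligned_def)
  qed
  \<comment> \<open>The two infima are taken in turn, first over the pairs for \<open>f2\<close> and
    \<open>f3\<close> with \<open>u\<close> and \<open>v\<close> fixed.\<close>
  have "D f1 f3 - word_dist d u v \<le> D f2 f3" if "aligned f1 f2 u v" for u v
  proof (rule D_greatest)
    fix v' w assume "aligned f2 f3 v' w"
    from *[OF that this] show "D f1 f3 - word_dist d u v \<le> word_dist d v' w" by simp
  qed (use assms in auto)
  then have "D f1 f3 - D f2 f3 \<le> D f1 f2"
    using assms by (intro D_greatest) (auto simp: diff_le_eq add.commute)
  then show ?thesis by simp
qed

text \<open>The added words are matched with themselves at cost 0.\<close>

lemma D_append_le:
  assumes "p \<in> words G" "q \<in> words G" "f1 \<in> words G" "f2 \<in> words G"
  shows "D (p @ f1 @ q) (p @ f2 @ q) \<le> D f1 f2"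
proof (rule D_greatest)
  fix u v assume uv: "aligned f1 f2 u v"
  then have "aligned (p @ f1 @ q) (p @ f2 @ q) (p @ u @ q) (p @ v @ q)"
    using assms by (auto simp: aligned_def intro: amal_eq_cong)
  from D_le[OF this] show "D (p @ f1 @ q) (p @ f2 @ q) \<le> word_dist d u v"
    using uv assms by (simp add: aligned_def)
qed (use assms in auto)

text \<open>Both inequalities come from \<open>D_append_le\<close>, once for \<open>h\<close> and
  once for its inverse.\<close>

lemma D_left:
  assumes "h \<in> words G" "f1 \<in> words G" "f2 \<in> words G"
  shows "D (h @ f1) (h @ f2) = D f1 f2"
proof (rule antisym)
  have "(winv h @ h @ f, f) \<in> amal_eq G" if "f \<in> words G" for f
    using amal_eq_cong[OF winv_cancel(2)[of h], of "[]" f] assms that by simp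
  then have "D f1 f2 = D (winv h @ h @ f1) (winv h @ h @ f2)"
    using assms by (intro D_cong[symmetric]) auto
  then show "D f1 f2 \<le> D (h @ f1) (h @ f2)"
    using D_append_le[of "winv h" "[]" "h @ f1" "h @ f2"] assms by simp
  show "D (h @ f1) (h @ f2) \<le> D f1 f2"
    using D_append_le[of h "[]" f1 f2] assms by simp
qed

lemma D_right:
  assumes "h \<in> words G" "f1 \<in> words G" "f2 \<in> words G"
  shows "D (f1 @ h) (f2 @ h) = D f1 f2"
proof (rule antisym)
  have "(f @ h @ winv h, f) \<in> amal_eq G" if "f \<in> words G" for f
    using amal_eq_cong[OF winv_cancel(1)[of h], of f "[]"] assms that by simp
  then have "D f1 f2 = D (f1 @ h @ winv h) (f2 @ h @ winv h)"
    using assms by (intro D_cong[symmetric]) auto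
  then show "D f1 f2 \<le> D (f1 @ h) (f2 @ h)"
    using D_append_le[of "[]" "winv h" "f1 @ h" "f2 @ h"] assms by simp
  show "D (f1 @ h) (f2 @ h) \<le> D f1 f2"
    using D_append_le[of "[]" h f1 f2] assms by simp
qed

section \<open>From the Graev distance to \<open>near\<close>\<close>

lemma lab_self: "w \<in> words G \<Longrightarrow> fits (lab w) w \<and> cost (lab w) w = 0"
proof (induction w)
  case (Cons x w)
  have "x \<in> carrier (G (SOME l. x \<in> carrier (G l)))"
    using Cons.prems by (auto simp: alphabet_def intro: someI)
  then show ?case using Cons by (simp add: lab_def)
qed (simp add: lab_def)

text \<open>A pair of words of cost below \<open>r\<close> is approximated by a labelled word and a
  witness. Appending the inverse of \<open>f2\<close> to both, matched with itself, makes the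
  witness trivial, and \<open>near_cong\<close> passes to \<open>w\<close>.\<close>

lemma near_if_D_less:
  assumes "f1 \<in> words G" "f2 \<in> words G" "D f1 f2 < r"
    and "labelled w" "(map snd w, f1 @ winv f2) \<in> amal_eq G"
  shows "near w r"
proof -
  obtain u v where uv: "aligned f1 f2 u v" "word_dist d u v < r"
    using D_lessE[OF assms(1-3)] .
  then obtain x zs where x: "labelled x" "fits x zs" "(map snd x, u) \<in> amal_eq G"
    "(zs, v) \<in> amal_eq G" "cost x zs < word_dist d u v + (r - word_dist d u v)"
    using word_approx[of u v "r - word_dist d u v"] unfolding aligned_def by auto
  have f1: "(map snd x, f1) \<in> amal_eq G" and f2: "(zs, f2) \<in> amal_eq G"
    using uv(1) amal_eq_trans[OF x(3)] amal_eq_trans[OF x(4)] unfolding aligned_def by simp_all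
  have "near (x @ lab (winv f2)) r"
  proof (rule nearI)
    show "fits (x @ lab (winv f2)) (zs @ winv f2)"
      using x lab_self assms by (intro list_all2_appendI) auto
    have "(zs @ winv f2, f2 @ winv f2) \<in> amal_eq G"
      using amal_eq_cong[OF f2, of "[]" "winv f2"] assms by simp
    then show "(zs @ winv f2, []) \<in> amal_eq G"
      using winv_cancel(1)[OF assms(2)] by (rule amal_eq_trans)
    show "cost (x @ lab (winv f2)) (zs @ winv f2) \<le> r"
      using x lab_self[of "winv f2"] assms fits_length[OF x(2)] by simp
  qed
  moreover have "(map snd (x @ lab (winv f2)), f1 @ winv f2) \<in> amal_eq G"
    using amal_eq_cong[OF f1, of "[]" "winv f2"] assms by (simp add: map_snd_lab)
  then have "(map snd (x @ lab (winv f2)), map snd w) \<in> amal_eq G"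
    using amal_eq_sym[OF assms(5)] by (rule amal_eq_trans)
  ultimately show ?thesis
    using near_cong[of _ _ "x @ lab (winv f2)" w] x lab_labelled assms by auto
qed

section \<open>Positivity\<close>

lemma cost_nonneg: "labelled w \<Longrightarrow> fits w zs \<Longrightarrow> 0 \<le> cost w zs"
  by (rotate_tac, induction rule: list_all2_induct) auto

text \<open>Since \<open>A\<close> is closed, each of the finitely many letters has positive
  distance from \<open>A\<close>; the minimum serves as a bound for all witnesses at once.\<close>

lemma cost_letter_in_A:
  assumes "labelled w" "\<forall>(l, x) \<in> set w. x \<notin> A"
  shows "\<exists>e>0. \<forall>zs. fits w zs \<and> (\<exists>z \<in> set zs. z \<in> A) \<longrightarrow> e \<le> cost w zs"
  using assms
proof (induction w)
  case (Cons p w)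
  obtain l x where p: "p = (l, x)" by force
  then have "x \<in> carrier (G l)" "x \<notin> A" using Cons.prems by auto
  then obtain e1 where e1: "e1 > 0" "\<And>a. a \<in> A \<Longrightarrow> e1 \<le> dl l x a"
    using closed[of l] unfolding metric_closed_in_def by (meson not_le)
  obtain e2 where e2: "e2 > 0" "\<And>zs. fits w zs \<Longrightarrow> \<exists>z \<in> set zs. z \<in> A \<Longrightarrow> e2 \<le> cost w zs"
    using Cons p by auto
  have "min e1 e2 \<le> cost (p # w) zs" if fits: "fits (p # w) zs" and A: "\<exists>z \<in> set zs. z \<in> A" for zs
  proof -
    obtain z vs where zs: "zs = z # vs" "z \<in> carrier (G l)" "fits w vs"
      using fits p by (auto simp: list_all2_Cons1)
    have nn: "0 \<le> dl l x z" "0 \<le> cost w vs"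
      using zs Cons.prems p cost_nonneg by auto
    have "z \<in> A \<or> (\<exists>z \<in> set vs. z \<in> A)" using A zs by auto
    then have "e1 \<le> dl l x z \<or> e2 \<le> cost w vs" using e1(2) e2(2) zs(3) by blast
    then show ?thesis using nn zs p by auto
  qed
  then show ?case using e1 e2 by (intro exI[of _ "min e1 e2"]) auto
qed (auto intro: exI[of _ 1])

text \<open>Otherwise the witness with the labels of \<open>w\<close> would itself be reduced, hence
  not longer than the empty word.\<close>

lemma trivial_letter_in_A:
  assumes "reduced w" "w \<noteq> []" "fits w zs" "(zs, []) \<in> amal_eq G"
  shows "\<exists>z \<in> set zs. z \<in> A"
proof (rule ccontr)
  assume "\<not> ?thesis"
  then have "reduced (zip (map fst w) zs)"
    using assms(1) fits_zip(3)[OF assms(3)] unfolding reduced_def by (auto dest: set_zip_rightD)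
  then have "length (zip (map fst w) zs) \<le> length ([] :: 'a list)"
    using assms fits_zip[OF assms(3)] by (intro reduced_length_le) auto
  then show False using assms fits_length[OF assms(3)] by simp
qed

text \<open>Merging preserves hypothesis and conclusion. For one letter the only witness is the
  identity, so the letter has distance 0 from it. A reduced word of length at least 2 is impossible,
  since its witnesses meet \<open>A\<close> and so have cost bounded away from 0.\<close>

lemma trivial_if_near:
  assumes "labelled w" "\<And>r. r > 0 \<Longrightarrow> near w r"
  shows "(map snd w, []) \<in> amal_eq G"
  using assms
proof (induction rule: labelled_induct)
  case (single l x)
  \<comment> \<open>The form \<open>0 + r\<close> is the one that \<open>field_le_epsilon\<close>
    expects.\<close>
  have "dl l x \<one>\<^bsub>G l\<^esub> \<le> 0 + r" if "r > 0" for r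
  proof -
    have "near ([] @ (l, x) # []) r" using single(2)[OF that] by simp
    then obtain z where z: "z \<in> carrier (G l)" "([z], []) \<in> amal_eq G" "dl l x z \<le> r"
      by (elim nearE) auto
    then have "z = \<one>\<^bsub>G l\<^esub>" using amal_eq_single_one by blast
    then show ?thesis using z by simp
  qed
  then have "dl l x \<one>\<^bsub>G l\<^esub> \<le> 0" by (rule field_le_epsilon)
  then have "dl l x \<one>\<^bsub>G l\<^esub> = 0"
    using single(1) by (intro antisym dl_nonneg) simp_all
  then have "x = \<one>\<^bsub>G l\<^esub>" using dl_eq_0_iff single(1) G_simps(2) by blast
  then show ?case using amal_eq_one[of "[]" "[]" l] by simp
next
  case (reduced w)
  obtain e where e: "e > 0"
    "\<And>zs. fits w zs \<Longrightarrow> \<exists>z \<in> set zs. z \<in> A \<Longrightarrow> e \<le> cost w zs"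
    using cost_letter_in_A[of w] reduced by (auto simp: reduced_def)
  then obtain zs where zs: "fits w zs" "(zs, []) \<in> amal_eq G" "cost w zs \<le> e / 2"
    using reduced(4)[of "e / 2"] unfolding near_def by auto
  have "w \<noteq> []" using reduced by auto
  from e(2)[OF zs(1) trivial_letter_in_A[OF reduced(2) this zs(1,2)]] show ?case
    using zs e by simp
next
  case (mergeL u m x k y v)
  have eq: "(map snd (u @ (m, x) # (k, y) # v), map snd (u @ (k, x \<otimes>\<^bsub>G k\<^esub> y) # v)) \<in> amal_eq G"
    using amal_eq_mult[of x k y "map snd u" "map snd v"] mergeL labelled_words[of u]
      labelled_words[of v] by (simp add: words_def)
  have "near (u @ (k, x \<otimes>\<^bsub>G k\<^esub> y) # v) r" if "r > 0" for r
    by (rule near_cong[OF eq, THEN iffD1, OF _ _ _ _ mergeL.prems[OF that]]) (use mergeL.hyps in auto)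
  then show ?case using mergeL.IH amal_eq_trans[OF eq] by blast
next
  case (mergeR u m x k y v)
  have eq: "(map snd (u @ (m, x) # (k, y) # v), map snd (u @ (m, x \<otimes>\<^bsub>G m\<^esub> y) # v)) \<in> amal_eq G"
    using amal_eq_mult[of x m y "map snd u" "map snd v"] mergeR labelled_words[of u]
      labelled_words[of v] by (simp add: words_def)
  have "near (u @ (m, x \<otimes>\<^bsub>G m\<^esub> y) # v) r" if "r > 0" for r
    by (rule near_cong[OF eq, THEN iffD1, OF _ _ _ _ mergeR.prems[OF that]]) (use mergeR.hyps in auto)
  then show ?case using mergeR.IH amal_eq_trans[OF eq] by blast
qed simp

lemma D_eq_0_iff:
  assumes "f1 \<in> words G" "f2 \<in> words G"
  shows "D f1 f2 = 0 \<longleftrightarrow> (f1, f2) \<in> amal_eq G"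
proof
  assume "(f1, f2) \<in> amal_eq G"
  then have "D f1 f2 = D f2 f2" by (simp add: D_cong)
  \<comment> \<open>Only \<open>u\<close> is kept: a nonempty representative of \<open>f2\<close>,
    to be paired with itself at cost 0.\<close>
  moreover obtain u v where "aligned f2 f2 u v" using ex_aligned assms by blast
  then have "aligned f2 f2 u u" "u \<in> words G" by (auto simp: aligned_def)
  then have "D f2 f2 \<le> 0" using D_le by fastforce
  ultimately show "D f1 f2 = 0" using D_nonneg[OF assms] by simp
next
  assume "D f1 f2 = 0"
  then have "near (lab (f1 @ winv f2)) r" if "r > 0" for r
    using that assms lab_labelled[of "f1 @ winv f2"]
    by (intro near_if_D_less[of f1 f2]) (auto simp: map_snd_lab)
  then have "(f1 @ winv f2, []) \<in> amal_eq G"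
    using trivial_if_near[of "lab (f1 @ winv f2)"] lab_labelled[of "f1 @ winv f2"] assms
    by (simp add: map_snd_lab)
  then have "(f1 @ winv f2, f2 @ winv f2) \<in> amal_eq G"
    using amal_eq_sym[OF winv_cancel(1)[OF assms(2)]] by (rule amal_eq_trans)
  then show "(f1, f2) \<in> amal_eq G"
    by (rule amal_eq_cancel_right) (use assms in auto)
qed

text \<open>The quotient of \<open>x\<close> and \<open>y\<close> is represented by one or two
  letters, whose trivial witnesses are explicit. In a common factor the witness is the identity.
  Otherwise it consists of \<open>a\<close> and its inverse, so \<open>a\<close> lies in both
  factors, hence in \<open>A\<close>, and is one of the points over which the infimum defining
  \<open>d\<close> is taken.\<close>

lemma amal_metric_le_D:
  assumes "x \<in> alphabet G" "y \<in> alphabet G"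
  shows "d x y \<le> D [x] [y]"
proof (rule dense_ge)
  fix r assume r: "D [x] [y] < r"
  obtain l m where lm: "x \<in> carrier (G l)" "y \<in> carrier (G m)"
    using assms by (auto simp: alphabet_def)
  have winv: "winv [y] = [inv\<^bsub>G m\<^esub> y]" using linv_eq[OF lm(2)] by (simp add: winv_def)
  show "d x y \<le> r"
  proof (cases "\<exists>l. x \<in> carrier (G l) \<and> y \<in> carrier (G l)")
    case True
    then obtain k where k: "x \<in> carrier (G k)" "y \<in> carrier (G k)" by blast
    let ?g = "x \<otimes>\<^bsub>G k\<^esub> inv\<^bsub>G k\<^esub> y"
    have "winv [y] = [inv\<^bsub>G k\<^esub> y]" using linv_eq[OF k(2)] by (simp add: winv_def)
    then have "([?g], [x] @ winv [y]) \<in> amal_eq G"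
      using amal_eq_sym[OF amal_eq_mult[of x k "inv\<^bsub>G k\<^esub> y" "[]" "[]"]] k by simp
    then have "near ([] @ (k, ?g) # []) r"
      using near_if_D_less[of "[x]" "[y]" r "[(k, ?g)]"] r k assms by simp
    then obtain z where z: "z \<in> carrier (G k)" "([z], []) \<in> amal_eq G" "dl k ?g z \<le> r"
      by (elim nearE) auto
    then have "z = \<one>\<^bsub>G k\<^esub>" using amal_eq_single_one by blast
    then show ?thesis using z dl_right[of "inv\<^bsub>G k\<^esub> y" k x y] k d_common[OF k] by simp
  next
    case False
    let ?w = "[(l, x), (m, inv\<^bsub>G m\<^esub> y)]"
    have "near ?w r"
      using near_if_D_less[of "[x]" "[y]" r ?w] r lm assms winv by simp
    then obtain a b where ab: "a \<in> carrier (G l)" "b \<in> carrier (G m)" "([a, b], []) \<in> amal_eq G"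
      "dl l x a + dl m (inv\<^bsub>G m\<^esub> y) b \<le> r"
      unfolding near_def by (auto simp: list_all2_Cons1)
    let ?b = "inv\<^bsub>G m\<^esub> b"
    have "([?b, b], []) \<in> amal_eq G"
      using winv_cancel(2)[of "[b]"] ab linv_eq[OF ab(2)] by (simp add: winv_def)
    then have "([a, b], [?b, b]) \<in> amal_eq G"
      by (rule amal_eq_trans[OF ab(3) amal_eq_sym])
    then have "([a] @ [b], [?b] @ [b]) \<in> amal_eq G" by simp
    then have "([a], [?b]) \<in> amal_eq G"
      by (rule amal_eq_cancel_right) (use ab carrier_alphabet[of ?b m] in auto)
    then have a: "a = ?b" using ab carrier_alphabet[of ?b m] by (intro amal_eq_single) auto
    then have "a \<in> carrier (G m)" using ab by simp
    moreover have "l \<noteq> m" using False lm by blast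
    ultimately have "a \<in> A" using ab in_A_if_two_factors by blast
    \<comment> \<open>Inversion is an isometry and \<open>b\<close> is the inverse of
      \<open>a\<close>, so the second letter pays for the way from \<open>a\<close> to
      \<open>y\<close>.\<close>
    have "dl m (inv\<^bsub>G m\<^esub> y) b = dl m a y"
      using dl_inv[of y m ?b] a ab lm dl_sym[of y m ?b] by simp
    moreover have "d x y \<le> dl l x a + dl m a y"
      unfolding d_not_common[OF False]
      by (rule cInf_lower) (use \<open>a \<in> A\<close> lm detours_nonneg in \<open>auto intro!: bdd_belowI[of _ 0]\<close>)
    ultimately show ?thesis using ab by simp
  qed
qed

lemma D_single:
  assumes "x \<in> alphabet G" "y \<in> alphabet G"
  shows "D [x] [y] = d x y"
proof (rule antisym)
  have "aligned [x] [y] [x] [y]" using assms by (simp add: aligned_def)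
  from D_le[OF this] show "D [x] [y] \<le> d x y" by simp
qed (rule amal_metric_le_D[OF assms])

end

theorem mainTheorem1:
  fixes G :: "'i \<Rightarrow> 'a monoid" and A :: "'a set" and dl :: "'i \<Rightarrow> 'a \<Rightarrow> 'a \<Rightarrow> real"
  assumes grp: "\<And>l. group (G l)"
    and metric: "\<And>l. two_sided_inv_metric (G l) (dl l)"
    and sub: "\<And>l. subgroup A (G l)"
    and A_mult: "\<And>l1 l2 a b. a \<in> A \<Longrightarrow> b \<in> A \<Longrightarrow> a \<otimes>\<^bsub>G l1\<^esub> b = a \<otimes>\<^bsub>G l2\<^esub> b"
    and closed: "\<And>l. metric_closed_in A (G l) (dl l)"
    and inter: "\<And>l1 l2. l1 \<noteq> l2 \<Longrightarrow> carrier (G l1) \<inter> carrier (G l2) = A"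
    and A_metric: "\<And>l1 l2 a b. a \<in> A \<Longrightarrow> b \<in> A \<Longrightarrow> dl l1 a b = dl l2 a b"
  shows
    "(\<forall>f1\<in>words G. \<forall>f1'\<in>words G. \<forall>f2\<in>words G. (f1, f1') \<in> amal_eq G \<longrightarrow>
         graev_amal G A dl f1 f2 = graev_amal G A dl f1' f2 \<and>
         graev_amal G A dl f2 f1 = graev_amal G A dl f2 f1')
     \<and> (\<forall>f1\<in>words G. \<forall>f2\<in>words G.
         graev_amal G A dl f1 f2 \<ge> 0 \<and>
         (graev_amal G A dl f1 f2 = 0 \<longleftrightarrow> (f1, f2) \<in> amal_eq G) \<and>
         graev_amal G A dl f1 f2 = graev_amal G A dl f2 f1)
     \<and> (\<forall>f1\<in>words G. \<forall>f2\<in>words G. \<forall>f3\<in>words G.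
         graev_amal G A dl f1 f3 \<le> graev_amal G A dl f1 f2 + graev_amal G A dl f2 f3)
     \<and> (\<forall>h\<in>words G. \<forall>f1\<in>words G. \<forall>f2\<in>words G.
         graev_amal G A dl (h @ f1) (h @ f2) = graev_amal G A dl f1 f2 \<and>
         graev_amal G A dl (f1 @ h) (f2 @ h) = graev_amal G A dl f1 f2)
     \<and> (\<forall>g1\<in>alphabet G. \<forall>g2\<in>alphabet G.
         graev_amal G A dl [g1] [g2] = amal_metric G A dl g1 g2)"
proof -
  interpret metric_amalgam G A dl
    by (intro metric_amalgam.intro group_amalgam.intro metric_amalgam_axioms.intro)
      (fact grp sub A_mult inter metric closed A_metric)+
  show ?thesis
    \<comment> \<open>Here \<open>amal_eq_refl\<close> serves the argument that stays fixed when
      \<open>D_cong\<close> is applied.\<close>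
    by (intro conjI ballI impI;
        (rule D_nonneg | rule D_eq_0_iff | rule D_triangle | rule D_left | rule D_right
          | rule D_single | rule D_sym | rule D_cong);
        (assumption | rule amal_eq_refl))
qed

end
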